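(* Let $\mathcal{K}$ be a non-trivial strong Fraïssé class in a finite relational language, with countably many isomorphism types, and let $X$ be an infinite set. Assume that for every finite $n\geq 1$ with $\aleph_n\leq|X|$, the class $\mathcal{K}$ has the disjoint $(n+1)$-amalgamation property. Then $\mathbb{C}_X(\mathcal{K})\simeq\mathbb{C}[X]$.
   Context: Structures are allowed to be empty. A Fraïssé class is a class of finite structures in a relational language, closed under isomorphism and substructures, with the joint embedding and amalgamation properties. It is strong if it has strong amalgamation: for all embeddings $f_i\colon\mathcal{A}\to\mathcal{B}_i$ ($i=0,1$) between members of $\mathcal{K}$ there are $\mathcal{C}\in\mathcal{K}$ and embeddings $g_i\colon\mathcal{B}_i\to\mathcal{C}$ with $g_0f_0=g_1f_1$ and $g_0[B_0]\cap g_1[B_1]=g_0f_0[A]$. It is non-trivial if there are two distinct structures in $\mathcal{K}$ with the same underlying set. For $n\geq1$, $\mathcal{K}$ has the disjoint $n$-amalgamation property ($n$-DAP) if whenever $\mathcal{A}_0,\dots,\mathcal{A}_{n-1}\in\mathcal{K}$ (with underlying sets $A_0,\dots,A_{n-1}$) satisfy $\mathcal{A}_i\upharpoonright(A_i\cap A_j)=\mathcal{A}_j\upharpoonright(A_i\cap A_j)$ for all $i<j<n$, there is $\mathcal{B}\in\mathcal{K}$ such that each $\mathcal{A}_i$ is a substructure of $\mathcal{B}$. $\mathbb{C}_X(\mathcal{K})$ is the partial order whose elements are the structures $\mathcal{A}\in\mathcal{K}$ whose underlying set is a (finite) subset of $X$, ordered by reverse inclusion: $\mathcal{B}\leq\mathcal{A}$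 iff $\mathcal{A}$ is a substructure of $\mathcal{B}$. Cohen forcing over $X$ is $\mathbb{C}[X]=\{p : p\colon X_0\to 2\text{ for some finite }X_0\subseteq X\}$, ordered by reverse inclusion. For a partial order $\mathbb{P}$, $\operatorname{RO}(\mathbb{P})$ is the complete Boolean algebra of regular open subsets of $\mathbb{P}$, where the open sets are the downward closed sets. $\mathbb{P}\simeq\mathbb{Q}$ means $\operatorname{RO}(\mathbb{P})\cong\operatorname{RO}(\mathbb{Q})$. *)

theory Defs
  imports "HOL-Analysis.Abstract_Topology"
begin

section \<open>Relational structures\<close>

text \<open>
  The symbols of the relational language are the elements of a type \<open>'r\<close>, with arities given by a
  function \<open>ar\<close>; the language is finite when \<open>'r\<close> is of class \<open>finite\<close>. Underlying
  sets are subsets of a type \<open>'a\<close>. Interpretations may only contain tuples of the right length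
  over the underlying set, so that equality of well-formed structures is equality of
  underlying sets and relations. The underlying set may be empty.
\<close>

datatype ('r, 'a) rstruct = RStruct (univ: "'a set") (interp: "'r \<Rightarrow> 'a list set")

definition is_struct :: "('r \<Rightarrow> nat) \<Rightarrow> ('r, 'a) rstruct \<Rightarrow> bool" where
  "is_struct ar A \<longleftrightarrow> (\<forall>R. \<forall>xs \<in> interp A R. length xs = ar R \<and> set xs \<subseteq> univ A)"

definition restrict_struct :: "('r, 'a) rstruct \<Rightarrow> 'a set \<Rightarrow> ('r, 'a) rstruct" where
  "restrict_struct A S = RStruct (univ A \<inter> S) (\<lambda>R. interp A R \<inter> lists S)"

definition substructure :: "('r, 'a) rstruct \<Rightarrow> ('r, 'a) rstruct \<Rightarrow> bool" where
  "substructure A B \<longleftrightarrow> univ A \<subseteq> univ B \<and> A = restrict_struct B (univ A)"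

definition embedding :: "('a \<Rightarrow> 'b) \<Rightarrow> ('r, 'a) rstruct \<Rightarrow> ('r, 'b) rstruct \<Rightarrow> bool" where
  "embedding f A B \<longleftrightarrow> inj_on f (univ A) \<and> f ` univ A \<subseteq> univ B \<and>
     (\<forall>R. \<forall>xs \<in> lists (univ A). xs \<in> interp A R \<longleftrightarrow> map f xs \<in> interp B R)"

definition isomorphic :: "('r, 'a) rstruct \<Rightarrow> ('r, 'b) rstruct \<Rightarrow> bool" where
  "isomorphic A B \<longleftrightarrow> (\<exists>f. embedding f A B \<and> f ` univ A = univ B)"


section \<open>Classes of finite structures\<close>

text \<open>
  A class of finite structures is represented by its members with underlying set in \<open>'a\<close>. When
  \<open>'a\<close> is infinite these include an isomorphic copy of every member of the class, so no
  information is lost.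
\<close>

definition joint_embedding :: "('r, 'a) rstruct set \<Rightarrow> bool" where
  "joint_embedding K \<longleftrightarrow>
     (\<forall>A \<in> K. \<forall>B \<in> K. \<exists>C \<in> K. \<exists>f g. embedding f A C \<and> embedding g B C)"

definition amalgamation :: "('r, 'a) rstruct set \<Rightarrow> bool" where
  "amalgamation K \<longleftrightarrow>
     (\<forall>A \<in> K. \<forall>B0 \<in> K. \<forall>B1 \<in> K. \<forall>f0 f1. embedding f0 A B0 \<and> embedding f1 A B1 \<longrightarrow>
        (\<exists>C \<in> K. \<exists>g0 g1. embedding g0 B0 C \<and> embedding g1 B1 C \<and>
           (\<forall>x \<in> univ A. g0 (f0 x) = g1 (f1 x))))"

definition strong_amalgamation :: "('r, 'a) rstruct set \<Rightarrow> bool" where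
  "strong_amalgamation K \<longleftrightarrow>
     (\<forall>A \<in> K. \<forall>B0 \<in> K. \<forall>B1 \<in> K. \<forall>f0 f1. embedding f0 A B0 \<and> embedding f1 A B1 \<longrightarrow>
        (\<exists>C \<in> K. \<exists>g0 g1. embedding g0 B0 C \<and> embedding g1 B1 C \<and>
           (\<forall>x \<in> univ A. g0 (f0 x) = g1 (f1 x)) \<and>
           g0 ` univ B0 \<inter> g1 ` univ B1 = (\<lambda>x. g0 (f0 x)) ` univ A))"

definition fraisse_class :: "('r \<Rightarrow> nat) \<Rightarrow> ('r, 'a) rstruct set \<Rightarrow> bool" where
  "fraisse_class ar K \<longleftrightarrow>
     (\<forall>A \<in> K. is_struct ar A \<and> finite (univ A)) \<and>
     (\<forall>A \<in> K. \<forall>B. is_struct ar B \<and> isomorphic A B \<longrightarrow> B \<in> K) \<and>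
     (\<forall>B \<in> K. \<forall>A. substructure A B \<longrightarrow> A \<in> K) \<and>
     joint_embedding K \<and> amalgamation K"

definition strong_fraisse_class :: "('r \<Rightarrow> nat) \<Rightarrow> ('r, 'a) rstruct set \<Rightarrow> bool" where
  "strong_fraisse_class ar K \<longleftrightarrow> fraisse_class ar K \<and> strong_amalgamation K"

definition nontrivial_class :: "('r, 'a) rstruct set \<Rightarrow> bool" where
  "nontrivial_class K \<longleftrightarrow> (\<exists>A \<in> K. \<exists>B \<in> K. univ A = univ B \<and> A \<noteq> B)"

definition countably_many_iso_types :: "('r, 'a) rstruct set \<Rightarrow> bool" where
  "countably_many_iso_types K \<longleftrightarrow> countable (K // {(A, B). A \<in> K \<and> B \<in> K \<and> isomorphic A B})"

definition disjoint_amalgamation :: "nat \<Rightarrow> ('r, 'a) rstruct set \<Rightarrow> bool" where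
  "disjoint_amalgamation n K \<longleftrightarrow>
     (\<forall>A. (\<forall>i<n. A i \<in> K) \<and>
          (\<forall>i j. i < j \<and> j < n \<longrightarrow>
             restrict_struct (A i) (univ (A i) \<inter> univ (A j)) =
             restrict_struct (A j) (univ (A i) \<inter> univ (A j))) \<longrightarrow>
        (\<exists>B \<in> K. \<forall>i<n. substructure (A i) B))"


section \<open>Comparing a set with the cardinals aleph-n\<close>

context
  includes cardinal_syntax
begin

text \<open>
  \<open>is_aleph n r\<close> says that \<open>r\<close> is a copy, on a subset of \<open>'a\<close>, of the cardinal aleph-\<open>n\<close>.
  As \<open>cardSuc\<close> raises the type, a copy in \<open>'a\<close> is taken at every step. This suffices for comparing
  aleph-\<open>n\<close> with a set \<open>X :: 'a set\<close>: if aleph-\<open>n\<close> is at most the cardinality of \<open>X\<close>, then it and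
  all smaller cardinals have copies in \<open>'a\<close>.
\<close>

primrec is_aleph :: "nat \<Rightarrow> 'a rel \<Rightarrow> bool" where
  "is_aleph 0 r \<longleftrightarrow> r =o natLeq"
| "is_aleph (Suc n) r \<longleftrightarrow> (\<exists>s :: 'a rel. is_aleph n s \<and> r =o cardSuc s)"

definition aleph_le :: "nat \<Rightarrow> 'a set \<Rightarrow> bool" where
  "aleph_le n X \<longleftrightarrow> (\<exists>r :: 'a rel. is_aleph n r \<and> r \<le>o |X| )"

end


section \<open>Regular open algebras\<close>

definition regular_opens :: "'p topology \<Rightarrow> 'p set set" where
  "regular_opens T = {U. U = T interior_of (T closure_of U)}"

definition ro_Sup :: "'p topology \<Rightarrow> 'p set set \<Rightarrow> 'p set" where
  "ro_Sup T F = T interior_of (T closure_of \<Union>F)"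

definition ro_Inf :: "'p topology \<Rightarrow> 'p set set \<Rightarrow> 'p set" where
  "ro_Inf T F = T interior_of (topspace T \<inter> \<Inter>F)"

definition ro_compl :: "'p topology \<Rightarrow> 'p set \<Rightarrow> 'p set" where
  "ro_compl T U = T interior_of (topspace T - U)"

text \<open>Isomorphism of the complete Boolean algebras of regular open sets; the empty family
  accounts for the bottom and top elements.\<close>

definition ro_isomorphic :: "'p topology \<Rightarrow> 'q topology \<Rightarrow> bool" where
  "ro_isomorphic S T \<longleftrightarrow>
     (\<exists>h. bij_betw h (regular_opens S) (regular_opens T) \<and>
          (\<forall>F. F \<subseteq> regular_opens S \<longrightarrow> h (ro_Sup S F) = ro_Sup T (h ` F)) \<and>
          (\<forall>F. F \<subseteq> regular_opens S \<longrightarrow> h (ro_Inf S F) = ro_Inf T (h ` F)) \<and>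
          (\<forall>U \<in> regular_opens S. h (ro_compl S U) = ro_compl T (h U)))"


section \<open>Forcing notions\<close>

text \<open>
  A partial order is represented by its reflexive order relation \<open>P\<close>, with underlying set
  \<open>Field P\<close>; \<open>(q, p) \<in> P\<close> means that \<open>q\<close> is below (stronger than) \<open>p\<close>.
\<close>

definition downset_topology :: "'p rel \<Rightarrow> 'p topology" where
  "downset_topology P = topology (\<lambda>U. U \<subseteq> Field P \<and> (\<forall>p \<in> U. \<forall>q. (q, p) \<in> P \<longrightarrow> q \<in> U))"

lemma openin_downset_topology:
  "openin (downset_topology P) U \<longleftrightarrow> U \<subseteq> Field P \<and> (\<forall>p \<in> U. \<forall>q. (q, p) \<in> P \<longrightarrow> q \<in> U)"
proof -
  have "istopology (\<lambda>U. U \<subseteq> Field P \<and> (\<forall>p \<in> U. \<forall>q. (q, p) \<in> P \<longrightarrow> q \<in> U))"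
    unfolding istopology_def by blast
  then show ?thesis
    by (simp add: downset_topology_def)
qed

lemma topspace_downset_topology: "topspace (downset_topology P) = Field P"
  unfolding topspace_def openin_downset_topology by (auto intro: FieldI1)

definition forcing_equivalent :: "'p rel \<Rightarrow> 'q rel \<Rightarrow> bool" where
  "forcing_equivalent P Q \<longleftrightarrow> ro_isomorphic (downset_topology P) (downset_topology Q)"

definition struct_forcing :: "'a set \<Rightarrow> ('r, 'a) rstruct set \<Rightarrow> ('r, 'a) rstruct rel" where
  "struct_forcing X K =
     {(B, A). B \<in> K \<and> A \<in> K \<and> univ B \<subseteq> X \<and> univ A \<subseteq> X \<and> substructure A B}"

definition cohen_forcing :: "'a set \<Rightarrow> ('a \<rightharpoonup> bool) rel" where
  "cohen_forcing X =
     {(q, p). finite (dom q) \<and> dom q \<subseteq> X \<and> finite (dom p) \<and> dom p \<subseteq> X \<and> p \<subseteq>\<^sub>m q}"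

lemma substructure_refl:
  assumes "is_struct ar A"
  shows "substructure A A"
proof -
  have "interp A R \<inter> lists (univ A) = interp A R" for R
    using assms by (auto simp: is_struct_def)
  then show ?thesis
    by (simp add: substructure_def restrict_struct_def)
qed

lemma substructure_antisym:
  assumes "substructure A B" "substructure B A"
  shows "A = B"
proof (rule rstruct.expand, intro conjI ext)
  have A: "interp A R = interp B R \<inter> lists (univ A)" for R
    using assms(1) by (metis substructure_def restrict_struct_def rstruct.sel(2))
  have B: "interp B R = interp A R \<inter> lists (univ B)" for R
    using assms(2) by (metis substructure_def restrict_struct_def rstruct.sel(2))
  show "univ A = univ B"
    using assms unfolding substructure_def by blast
  show "interp A R = interp B R" for R
    using A[of R] B[of R] by blast
qed

lemma substructure_trans:
  assumes "substructure A B" "substructure B C"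
  shows "substructure A C"
proof -
  have sub: "univ A \<subseteq> univ B" "univ B \<subseteq> univ C"
    using assms unfolding substructure_def by blast+
  have A: "interp A R = interp B R \<inter> lists (univ A)" for R
    using assms(1) by (metis substructure_def restrict_struct_def rstruct.sel(2))
  have B: "interp B R = interp C R \<inter> lists (univ B)" for R
    using assms(2) by (metis substructure_def restrict_struct_def rstruct.sel(2))
  have "interp A R = interp C R \<inter> lists (univ A)" for R
    using A[of R] B[of R] lists_mono[OF sub(1)] by blast
  moreover have "univ C \<inter> univ A = univ A"
    using sub by blast
  ultimately show ?thesis
    using sub unfolding substructure_def restrict_struct_def
    by (intro conjI rstruct.expand) auto
qed

lemma struct_forcing_refl:
  assumes "fraisse_class ar K" "A \<in> K" "univ A \<subseteq> X"
  shows "(A, A) \<in> struct_forcing X K"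
proof -
  have "is_struct ar A"
    using assms(1,2) unfolding fraisse_class_def by blast
  then have "substructure A A"
    by (rule substructure_refl)
  then show ?thesis
    using assms(2,3) by (simp add: struct_forcing_def)
qed

lemma Field_struct_forcing:
  assumes "fraisse_class ar K"
  shows "Field (struct_forcing X K) = {A \<in> K. univ A \<subseteq> X}"
proof (intro equalityI subsetI)
  fix A assume "A \<in> Field (struct_forcing X K)"
  then show "A \<in> {A \<in> K. univ A \<subseteq> X}"
    unfolding Field_def struct_forcing_def by blast
next
  fix A assume "A \<in> {A \<in> K. univ A \<subseteq> X}"
  then show "A \<in> Field (struct_forcing X K)"
    using struct_forcing_refl[OF assms] by (blast intro: FieldI1)
qed

lemma Partial_order_struct_forcing:
  assumes "fraisse_class ar K"
  shows "Partial_order (struct_forcing X K)"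
  unfolding partial_order_on_def preorder_on_def
proof (intro conjI)
  show "struct_forcing X K \<subseteq> Field (struct_forcing X K) \<times> Field (struct_forcing X K)"
    by (auto intro: FieldI1 FieldI2)
  show "refl_on (Field (struct_forcing X K)) (struct_forcing X K)"
    by (rule refl_onI) (simp add: Field_struct_forcing[OF assms] struct_forcing_refl[OF assms])
  show "trans (struct_forcing X K)"
    by (auto simp: trans_def struct_forcing_def intro: substructure_trans)
  show "antisym (struct_forcing X K)"
    by (auto simp: antisym_def struct_forcing_def intro: substructure_antisym)
qed

lemma Field_cohen_forcing: "Field (cohen_forcing X) = {p. finite (dom p) \<and> dom p \<subseteq> X}"
  by (auto simp: cohen_forcing_def Field_def)

lemma Partial_order_cohen_forcing: "Partial_order (cohen_forcing X)"
  unfolding partial_order_on_def preorder_on_def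
proof (intro conjI)
  show "cohen_forcing X \<subseteq> Field (cohen_forcing X) \<times> Field (cohen_forcing X)"
    by (auto intro: FieldI1 FieldI2)
  show "refl_on (Field (cohen_forcing X)) (cohen_forcing X)"
    unfolding refl_on_def Field_cohen_forcing by (auto simp: cohen_forcing_def)
  show "trans (cohen_forcing X)"
    by (auto simp: trans_def cohen_forcing_def intro: map_le_trans)
  show "antisym (cohen_forcing X)"
    by (auto simp: antisym_def cohen_forcing_def intro: map_le_antisym)
qed

end

theory Submission
  imports Defs "HOL-Analysis.Finite_Cartesian_Product"
begin

text \<open>
  Regard \<open>X\<close> as covered by countable sets \<open>Y a\<close>, indexed by a well-order, such that every finite
  subset of \<open>X\<close> lies in some \<open>Y a\<close>, every \<open>Y a\<close> contains infinitely many new points, and the finite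
  sets contained in some \<open>Y b\<close> with \<open>b < a\<close> are the finite subsets of finitely many sets \<open>Z i\<close>,
  \<open>i < m\<close>, with aleph-\<open>m\<close> at most the cardinality of \<open>X\<close>. Such a system exists by induction on this
  cardinality: cut \<open>X\<close> into a well-ordered sequence of smaller blocks and treat a block together with
  the preceding ones, which costs one more set. Disjoint \<open>(m+1)\<close>-amalgamation, applied to a condition
  on \<open>Y a\<close> and the traces of another condition on the \<open>Z i\<close>, shows that the forcing on
  \<open>Y a\<close> is, over the part of the generic structure already known before \<open>a\<close>, a countable
  atomless forcing. Hence it adds one Cohen real over that part, which is read off explicitly as follows:
  enumerate the conditions \<open>A\<^sub>0, A\<^sub>1, \<dots>\<close> on \<open>Y a\<close>, ask successively
  whether \<open>A\<^sub>j\<close> belongs to the generic filter, and record the answers to those questions that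
  are not decided by the known part and the previous answers. The bits of all stages are independent and jointly
  determine the generic structure, so their Boolean values generate the algebra freely.
\<close>

section \<open>A criterion for equivalence with Cohen forcing\<close>

text \<open>Which queries remain open depends on the part of the generic structure known before the
  stage, so no fixed set of queries can serve as coordinates: the \<open>k\<close>-th recorded bit
  comes from different queries in different parts of the forcing. A condition therefore counts only
  once it has settled, for each of the first queries, both the answer and whether the query was
  open; the bit is then a property of the condition itself. No iteration and no generic extension is
  formed: the bits are downward closed sets of structures, and equivalence with Cohen forcing is
  reduced to three facts about them, namely disjointness of the two values, independence, and
  density of the finite intersections. On a countable set a single stage suffices and
  \<open>m = 0\<close>; every passage to a strictly larger set adds one to \<open>m\<close>, which
  is how the alephs enter. The coordinates are the pairs of a stage and a number. They can be
  indexed by \<open>X\<close> itself, because every stage is countable and has infinitely many new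
  points.\<close>

lemma interior_closure_downset:
  assumes "Partial_order P" and "openin (downset_topology P) W"
  shows "downset_topology P interior_of (downset_topology P closure_of W) =
    {p \<in> Field P. \<forall>q. (q, p) \<in> P \<longrightarrow> (\<exists>r \<in> W. (r, q) \<in> P)}"
proof -
  let ?T = "downset_topology P"
  have refl: "(p, p) \<in> P" if "p \<in> Field P" for p
    using assms(1) that by (auto simp: partial_order_on_def preorder_on_def refl_on_def)
  have trans: "(p, r) \<in> P" if "(p, q) \<in> P" "(q, r) \<in> P" for p q r
    using assms(1) that unfolding partial_order_on_def preorder_on_def trans_def by blast
  \<comment> \<open>The principal down-set is the least open neighbourhood of \<open>p\<close>, so
    closure and interior can both be tested on it alone.\<close>
  have down: "openin ?T {q. (q, p) \<in> P}" for p
    unfolding openin_downset_topology by (auto intro: trans FieldI1)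
  have cl: "?T closure_of W = {p \<in> Field P. \<exists>r \<in> W. (r, p) \<in> P}" (is "_ = ?C")
  proof (intro equalityI subsetI)
    fix p assume "p \<in> ?T closure_of W"
    then have "p \<in> Field P" "p \<in> U \<and> openin ?T U \<longrightarrow> (\<exists>y. y \<in> W \<and> y \<in> U)" for U
      unfolding in_closure_of topspace_downset_topology by blast+
    from this(1) this(2)[of "{q. (q, p) \<in> P}"] show "p \<in> ?C"
      using down[of p] refl[of p] by simp blast
  next
    fix p assume "p \<in> ?C"
    then obtain r where "p \<in> Field P" "r \<in> W" "(r, p) \<in> P"
      by blast
    then show "p \<in> ?T closure_of W"
      unfolding in_closure_of topspace_downset_topology openin_downset_topology by blast
  qed
  show ?thesis
  proof (intro equalityI subsetI)
    fix p assume "p \<in> ?T interior_of (?T closure_of W)"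
    then obtain U where "openin ?T U" "p \<in> U" "U \<subseteq> ?C"
      unfolding cl interior_of_def by blast
    then show "p \<in> {p \<in> Field P. \<forall>q. (q, p) \<in> P \<longrightarrow> (\<exists>r \<in> W. (r, q) \<in> P)}"
      unfolding openin_downset_topology by blast
  next
    fix p assume p: "p \<in> {p \<in> Field P. \<forall>q. (q, p) \<in> P \<longrightarrow> (\<exists>r \<in> W. (r, q) \<in> P)}"
    then have "{q. (q, p) \<in> P} \<subseteq> ?C" by (auto intro: FieldI1)
    with p down[of p] refl[of p] show "p \<in> ?T interior_of (?T closure_of W)"
      unfolding cl interior_of_def by blast
  qed
qed

text \<open>Used mostly in contrapositive form: a condition outside a regular open \<open>U\<close>
  has an extension below which \<open>U\<close> has no member.\<close>

lemma regular_opens_downset: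
  assumes "Partial_order P"
  shows "U \<in> regular_opens (downset_topology P) \<longleftrightarrow>
    openin (downset_topology P) U \<and>
    (\<forall>p \<in> Field P. (\<forall>q. (q, p) \<in> P \<longrightarrow> (\<exists>r \<in> U. (r, q) \<in> P)) \<longrightarrow> p \<in> U)"
    (is "_ \<longleftrightarrow> ?R")
proof
  assume "U \<in> regular_opens (downset_topology P)"
  then have U: "downset_topology P interior_of (downset_topology P closure_of U) = U"
    unfolding regular_opens_def by blast
  have op: "openin (downset_topology P) U"
    by (subst U[symmetric]) (rule openin_interior_of)
  from U show ?R
    using op interior_closure_downset[OF assms op] by blast
next
  assume R: ?R
  then have "U \<subseteq> downset_topology P interior_of (downset_topology P closure_of U)"
    by (intro interior_of_maximal closure_of_subset) (simp_all add: openin_subset)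
  moreover have "downset_topology P interior_of (downset_topology P closure_of U) \<subseteq> U"
    using R by (subst interior_closure_downset[OF assms]) auto
  ultimately show "U \<in> regular_opens (downset_topology P)"
    by (simp add: regular_opens_def)
qed

lemma regular_opensI:
  assumes "openin T U" "T interior_of (T closure_of U) \<subseteq> U"
  shows "U \<in> regular_opens T"
proof -
  have "U \<subseteq> T interior_of (T closure_of U)"
    using assms(1) by (intro interior_of_maximal closure_of_subset openin_subset)
  with assms(2) show ?thesis
    unfolding regular_opens_def by blast
qed

lemma regular_opensD:
  assumes "U \<in> regular_opens T"
  shows "openin T U" "T interior_of (T closure_of U) = U"
proof -
  show *: "T interior_of (T closure_of U) = U"
    using assms unfolding regular_opens_def by blast
  show "openin T U"
    by (subst *[symmetric]) (rule openin_interior_of)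
qed

lemma regular_opens_interior_closure: "T interior_of (T closure_of B) \<in> regular_opens T"
proof (rule regular_opensI)
  have "T closure_of (T interior_of (T closure_of B)) \<subseteq> T closure_of B"
    by (rule closure_of_minimal) (simp_all add: interior_of_subset)
  then show "T interior_of (T closure_of (T interior_of (T closure_of B))) \<subseteq> T interior_of (T closure_of B)"
    by (rule interior_of_mono)
qed simp

text \<open>This and the two lemmas that follow characterise the operations of the algebra by
  inclusion, so that an isomorphism need only be checked on the order.\<close>

lemma ro_Sup_lub:
  assumes "F \<subseteq> regular_opens T"
  shows "ro_Sup T F \<in> regular_opens T" "U \<in> F \<Longrightarrow> U \<subseteq> ro_Sup T F"
    "V \<in> regular_opens T \<Longrightarrow> (\<And>U. U \<in> F \<Longrightarrow> U \<subseteq> V) \<Longrightarrow> ro_Sup T F \<subseteq> V"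
proof -
  have op: "openin T (\<Union>F)"
    using assms regular_opensD(1) by blast
  show "ro_Sup T F \<in> regular_opens T"
    unfolding ro_Sup_def by (rule regular_opens_interior_closure)
  have "\<Union>F \<subseteq> ro_Sup T F"
    unfolding ro_Sup_def
    by (intro interior_of_maximal closure_of_subset op openin_subset)
  then show "U \<in> F \<Longrightarrow> U \<subseteq> ro_Sup T F"
    by blast
  show "ro_Sup T F \<subseteq> V" if "V \<in> regular_opens T" "\<And>U. U \<in> F \<Longrightarrow> U \<subseteq> V"
  proof -
    have "ro_Sup T F \<subseteq> T interior_of (T closure_of V)"
      unfolding ro_Sup_def using that(2) by (intro interior_of_mono closure_of_mono) blast
    then show ?thesis
      by (simp add: regular_opensD(2)[OF that(1)])
  qed
qed

lemma ro_Inf_glb: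
  assumes "F \<subseteq> regular_opens T"
  shows "ro_Inf T F \<in> regular_opens T" "U \<in> F \<Longrightarrow> ro_Inf T F \<subseteq> U"
    "V \<in> regular_opens T \<Longrightarrow> (\<And>U. U \<in> F \<Longrightarrow> V \<subseteq> U) \<Longrightarrow> V \<subseteq> ro_Inf T F"
proof -
  show lower: "ro_Inf T F \<subseteq> U" if "U \<in> F" for U
    unfolding ro_Inf_def using that interior_of_subset by fastforce
  have "T interior_of (T closure_of ro_Inf T F) \<subseteq> U" if "U \<in> F" for U
    using interior_of_mono[OF closure_of_mono[OF lower[OF that]], of T] regular_opensD(2)[of U T]
      assms that by blast
  then have "T interior_of (T closure_of ro_Inf T F) \<subseteq> topspace T \<inter> \<Inter>F"
    by (simp add: Inter_greatest interior_of_subset_topspace)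
  then have "T interior_of (T closure_of ro_Inf T F) \<subseteq> ro_Inf T F"
    unfolding ro_Inf_def by (intro interior_of_maximal) simp_all
  then show "ro_Inf T F \<in> regular_opens T"
    by (intro regular_opensI) (simp_all add: ro_Inf_def)
  show "V \<subseteq> ro_Inf T F" if "V \<in> regular_opens T" "\<And>U. U \<in> F \<Longrightarrow> V \<subseteq> U"
    unfolding ro_Inf_def using that regular_opensD(1)[OF that(1)]
    by (intro interior_of_maximal) (auto dest: openin_subset)
qed

lemma ro_compl_pseudocomplement:
  assumes "U \<in> regular_opens T"
  shows "ro_compl T U \<in> regular_opens T"
    "V \<in> regular_opens T \<Longrightarrow> V \<subseteq> ro_compl T U \<longleftrightarrow> V \<inter> U = {}"
proof -
  have op: "openin T U"
    using assms by (rule regular_opensD)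
  have disj: "ro_compl T U \<inter> U = {}"
    unfolding ro_compl_def using interior_of_subset by fastforce
  then have "T closure_of ro_compl T U \<inter> U = {}"
    using op by (simp add: Int_commute openin_Int_closure_of_eq_empty)
  then have "T interior_of (T closure_of ro_compl T U) \<subseteq> topspace T - U"
    using interior_of_subset[of T "T closure_of ro_compl T U"]
      interior_of_subset_topspace[of T "T closure_of ro_compl T U"] by blast
  then have "T interior_of (T closure_of ro_compl T U) \<subseteq> ro_compl T U"
    unfolding ro_compl_def by (intro interior_of_maximal) simp_all
  then show "ro_compl T U \<in> regular_opens T"
    by (intro regular_opensI) (simp_all add: ro_compl_def)
  show "V \<subseteq> ro_compl T U \<longleftrightarrow> V \<inter> U = {}" if "V \<in> regular_opens T"
  proof
    show "V \<subseteq> ro_compl T U" if "V \<inter> U = {}"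
      unfolding ro_compl_def using that regular_opensD(1)[OF \<open>V \<in> regular_opens T\<close>]
      by (intro interior_of_maximal) (auto dest: openin_subset)
  qed (use disj in blast)
qed

lemma regular_opens_Int:
  assumes "U \<in> regular_opens T" "V \<in> regular_opens T"
  shows "U \<inter> V \<in> regular_opens T"
proof (rule regular_opensI)
  show "openin T (U \<inter> V)"
    using assms by (blast intro: openin_Int regular_opensD(1))
  have "T interior_of (T closure_of (U \<inter> V)) \<subseteq> T interior_of (T closure_of W)" if "U \<inter> V \<subseteq> W" for W
    using that by (intro interior_of_mono closure_of_mono)
  from this[of U] this[of V] show "T interior_of (T closure_of (U \<inter> V)) \<subseteq> U \<inter> V"
    using assms by (simp add: regular_opensD(2))
qed

lemma empty_regular_open: "{} \<in> regular_opens T"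
  by (simp add: regular_opens_def)

text \<open>A bijection that preserves and reflects inclusion carries least upper and greatest lower
  bounds along. For complements, disjointness must be carried over: the intersection of two regular
  open sets is regular open, hence their meet, and the empty set is the bottom.\<close>

lemma ro_isomorphicI:
  assumes bij: "bij_betw h (regular_opens S) (regular_opens T)"
    and mono: "\<And>U V. U \<in> regular_opens S \<Longrightarrow> V \<in> regular_opens S \<Longrightarrow> h U \<subseteq> h V \<longleftrightarrow> U \<subseteq> V"
  shows "ro_isomorphic S T"
proof -
  have mem: "h U \<in> regular_opens T" if "U \<in> regular_opens S" for U
    using bij that by (rule bij_betw_apply)
  have onto: "\<exists>V \<in> regular_opens S. h V = W" if "W \<in> regular_opens T" for W
    using that bij_betw_imp_surj_on[OF bij, symmetric] by auto
  have im: "h ` F \<subseteq> regular_opens T" if "F \<subseteq> regular_opens S" for F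
    using mem that by blast
  have Sup: "h (ro_Sup S F) = ro_Sup T (h ` F)" if F: "F \<subseteq> regular_opens S" for F
  proof
    obtain V where V: "V \<in> regular_opens S" "h V = ro_Sup T (h ` F)"
      using onto[OF ro_Sup_lub(1)[OF im[OF F]]] by blast
    have "U \<subseteq> V" if "U \<in> F" for U
      using ro_Sup_lub(2)[OF im[OF F], of "h U"] mono[of U V] V F that by auto
    then show "h (ro_Sup S F) \<subseteq> ro_Sup T (h ` F)"
      using ro_Sup_lub(3)[OF F V(1)] mono[OF ro_Sup_lub(1)[OF F] V(1)] V(2) by simp
    show "ro_Sup T (h ` F) \<subseteq> h (ro_Sup S F)"
    proof (rule ro_Sup_lub(3)[OF im[OF F] mem[OF ro_Sup_lub(1)[OF F]]])
      fix W assume "W \<in> h ` F"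
      then obtain U where "U \<in> F" "W = h U"
        by blast
      then show "W \<subseteq> h (ro_Sup S F)"
        using mono[of U, OF _ ro_Sup_lub(1)[OF F]] ro_Sup_lub(2)[OF F, of U] F by blast
    qed
  qed
  have Inf: "h (ro_Inf S F) = ro_Inf T (h ` F)" if F: "F \<subseteq> regular_opens S" for F
  proof
    obtain V where V: "V \<in> regular_opens S" "h V = ro_Inf T (h ` F)"
      using onto[OF ro_Inf_glb(1)[OF im[OF F]]] by blast
    have "V \<subseteq> U" if "U \<in> F" for U
      using ro_Inf_glb(2)[OF im[OF F], of "h U"] mono[of V U] V F that by auto
    then show "ro_Inf T (h ` F) \<subseteq> h (ro_Inf S F)"
      using ro_Inf_glb(3)[OF F V(1)] mono[OF V(1) ro_Inf_glb(1)[OF F]] V(2) by simp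
    show "h (ro_Inf S F) \<subseteq> ro_Inf T (h ` F)"
    proof (rule ro_Inf_glb(3)[OF im[OF F] mem[OF ro_Inf_glb(1)[OF F]]])
      fix W assume "W \<in> h ` F"
      then obtain U where "U \<in> F" "W = h U"
        by blast
      then show "h (ro_Inf S F) \<subseteq> W"
        using mono[of _ U, OF ro_Inf_glb(1)[OF F]] ro_Inf_glb(2)[OF F, of U] F by blast
    qed
  qed
  have empty: "h {} = {}"
  proof -
    obtain V where "V \<in> regular_opens S" "h V = {}"
      using onto[OF empty_regular_open] by blast
    then show ?thesis
      using mono[OF empty_regular_open, of V] by simp
  qed
  have disj: "h U \<inter> h V = {} \<longleftrightarrow> U \<inter> V = {}"
    if UV: "U \<in> regular_opens S" "V \<in> regular_opens S" for U V
  proof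
    assume "h U \<inter> h V = {}"
    moreover have "h (U \<inter> V) \<subseteq> h U \<inter> h V"
      using mono regular_opens_Int[OF UV] UV by simp
    ultimately have "h (U \<inter> V) \<subseteq> h {}"
      by simp
    then show "U \<inter> V = {}"
      using mono[OF regular_opens_Int[OF UV] empty_regular_open] by simp
  next
    assume *: "U \<inter> V = {}"
    obtain W where W: "W \<in> regular_opens S" "h W = h U \<inter> h V"
      using onto[OF regular_opens_Int[OF mem[OF UV(1)] mem[OF UV(2)]]] by blast
    then have "W \<subseteq> U \<inter> V"
      using mono UV by (metis inf_le1 inf_le2 le_inf_iff)
    with W * empty show "h U \<inter> h V = {}"
      by simp
  qed
  have compl: "h (ro_compl S U) = ro_compl T (h U)" if U: "U \<in> regular_opens S" for U
  proof
    note c = ro_compl_pseudocomplement[OF U] and c' = ro_compl_pseudocomplement[OF mem[OF U]]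
    show "h (ro_compl S U) \<subseteq> ro_compl T (h U)"
      using c c' disj[OF c(1) U] mem by blast
    obtain V where V: "V \<in> regular_opens S" "h V = ro_compl T (h U)"
      using onto[OF c'(1)] by blast
    then have "V \<subseteq> ro_compl S U"
      using c(2) c' disj[OF V(1) U] by blast
    then show "ro_compl T (h U) \<subseteq> h (ro_compl S U)"
      using mono[OF V(1) c(1)] V(2) by simp
  qed
  show ?thesis
    unfolding ro_isomorphic_def using bij Sup Inf compl by blast
qed

section \<open>Cells of Cohen conditions\<close>

text \<open>\<open>V x b\<close> plays the Boolean value of the statement that the generic Cohen
  function takes the value \<open>b\<close> at \<open>x\<close>, and the cell is the image of the
  Cohen condition \<open>p\<close>. The conjunct \<open>c \<in> Field P\<close> makes the cell of
  the empty condition the whole order.\<close>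

definition cell :: "'p rel \<Rightarrow> ('a \<Rightarrow> bool \<Rightarrow> 'p set) \<Rightarrow> ('a \<rightharpoonup> bool) \<Rightarrow> 'p set" where
  "cell P V p = {c \<in> Field P. \<forall>x b. p x = Some b \<longrightarrow> c \<in> V x b}"

text \<open>By \<open>dense\<close>, some cell lies below any given condition up to regularisation,
  since all its members are compatible with that condition; by \<open>indep\<close> no cell is
  empty; by \<open>disj\<close> a common member of two cells makes the Cohen conditions compatible.
  So the cells form a copy of Cohen forcing that is dense in the regular open algebra of
  \<open>P\<close>.\<close>

lemma forcing_equivalent_cohenI:
  fixes P :: "'p rel" and X :: "'a set" and V :: "'a \<Rightarrow> bool \<Rightarrow> 'p set"
  assumes P: "Partial_order P"
    and down: "\<And>x b c d. x \<in> X \<Longrightarrow> c \<in> V x b \<Longrightarrow> (d, c) \<in> P \<Longrightarrow> d \<in> V x b"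
    and disj: "\<And>x. x \<in> X \<Longrightarrow> V x True \<inter> V x False = {}"
    and indep: "\<And>p. finite (dom p) \<Longrightarrow> dom p \<subseteq> X \<Longrightarrow> cell P V p \<noteq> {}"
    and dense: "\<And>c. c \<in> Field P \<Longrightarrow> \<exists>p. finite (dom p) \<and> dom p \<subseteq> X \<and>
      (\<forall>d \<in> cell P V p. \<exists>e. (e, c) \<in> P \<and> (e, d) \<in> P)"
  shows "forcing_equivalent P (cohen_forcing X)"
proof -
  let ?S = "downset_topology P" and ?T = "downset_topology (cohen_forcing X)"
  let ?Q = "cohen_forcing X"
  define Q where "Q = {p :: 'a \<rightharpoonup> bool. finite (dom p) \<and> dom p \<subseteq> X}"
  have FQ: "Field ?Q = Q"
    by (simp add: Q_def Field_cohen_forcing)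
  have leQ: "(q, p) \<in> ?Q \<longleftrightarrow> q \<in> Q \<and> p \<in> Q \<and> p \<subseteq>\<^sub>m q" for p q
    by (auto simp: Q_def cohen_forcing_def)
  have refl: "(c, c) \<in> P" if "c \<in> Field P" for c
    using P that by (auto simp: partial_order_on_def preorder_on_def refl_on_def)
  have trans: "(c, e) \<in> P" if "(c, d) \<in> P" "(d, e) \<in> P" for c d e
    using P that unfolding partial_order_on_def preorder_on_def trans_def by blast
  have roS: "U \<in> regular_opens ?S \<longleftrightarrow> U \<subseteq> Field P \<and> (\<forall>c \<in> U. \<forall>d. (d, c) \<in> P \<longrightarrow> d \<in> U) \<and>
      (\<forall>c \<in> Field P. (\<forall>d. (d, c) \<in> P \<longrightarrow> (\<exists>e \<in> U. (e, d) \<in> P)) \<longrightarrow> c \<in> U)" for U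
    by (simp add: regular_opens_downset[OF P] openin_downset_topology)
  have roT: "U \<in> regular_opens ?T \<longleftrightarrow> U \<subseteq> Q \<and> (\<forall>p \<in> U. \<forall>q \<in> Q. p \<subseteq>\<^sub>m q \<longrightarrow> q \<in> U) \<and>
      (\<forall>p \<in> Q. (\<forall>q \<in> Q. p \<subseteq>\<^sub>m q \<longrightarrow> (\<exists>r \<in> U. q \<subseteq>\<^sub>m r)) \<longrightarrow> p \<in> U)" for U
    unfolding regular_opens_downset[OF Partial_order_cohen_forcing] openin_downset_topology FQ leQ
  proof (intro iffI; elim conjE; intro conjI ballI impI allI)
    fix p q assume "U \<subseteq> Q" "\<forall>p\<in>U. \<forall>q\<in>Q. p \<subseteq>\<^sub>m q \<longrightarrow> q \<in> U" "p \<in> U" "q \<in> Q \<and> p \<in> Q \<and> p \<subseteq>\<^sub>m q"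
    then show "q \<in> U" by blast
  next
    fix p assume "U \<subseteq> Q"
      "\<forall>p\<in>Q. (\<forall>q\<in>Q. p \<subseteq>\<^sub>m q \<longrightarrow> (\<exists>r\<in>U. q \<subseteq>\<^sub>m r)) \<longrightarrow> p \<in> U"
      "p \<in> Q"
      "\<forall>q. q \<in> Q \<and> p \<in> Q \<and> p \<subseteq>\<^sub>m q \<longrightarrow> (\<exists>r\<in>U. r \<in> Q \<and> q \<in> Q \<and> q \<subseteq>\<^sub>m r)"
    then show "p \<in> U" by meson
  next
    fix p assume "U \<subseteq> Q"
      "\<forall>p\<in>Q. (\<forall>q. q \<in> Q \<and> p \<in> Q \<and> p \<subseteq>\<^sub>m q \<longrightarrow>
        (\<exists>r\<in>U. r \<in> Q \<and> q \<in> Q \<and> q \<subseteq>\<^sub>m r)) \<longrightarrow> p \<in> U"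
      "p \<in> Q"
      "\<forall>q\<in>Q. p \<subseteq>\<^sub>m q \<longrightarrow> (\<exists>r\<in>U. q \<subseteq>\<^sub>m r)"
    then show "p \<in> U" by (meson subsetD)
  qed (meson subsetD)+
  have cell_down: "d \<in> cell P V p" if "c \<in> cell P V p" "(d, c) \<in> P" "p \<in> Q" for c d p
    using that down unfolding cell_def Q_def by (fastforce intro: FieldI1)
  have cell_mono: "cell P V q \<subseteq> cell P V p" if "p \<subseteq>\<^sub>m q" for p q
    using that unfolding cell_def map_le_def by force
  have compat: "\<exists>r \<in> Q. p \<subseteq>\<^sub>m r \<and> q \<subseteq>\<^sub>m r" if "c \<in> cell P V p" "c \<in> cell P V q" "p \<in> Q" "q \<in> Q" for c p q
  proof
    have "p x = q x" if x: "x \<in> dom p" "x \<in> dom q" for x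
    proof -
      obtain a b where ab: "p x = Some a" "q x = Some b"
        using x by (auto simp: dom_def)
      then have "c \<in> V x a" "c \<in> V x b" "x \<in> X"
        using \<open>c \<in> cell P V p\<close> \<open>c \<in> cell P V q\<close> \<open>p \<in> Q\<close> by (auto simp: cell_def Q_def)
      with disj[of x] ab show ?thesis
        by (cases a; cases b) auto
    qed
    then have "\<forall>x. x \<in> dom p \<longrightarrow> x \<in> dom q \<longrightarrow> p x = q x"
      by blast
    then show "p \<subseteq>\<^sub>m p ++ q \<and> q \<subseteq>\<^sub>m p ++ q"
      unfolding map_le_def map_add_def by (metis domIff map_add_def option.exhaust option.simps(4,5))
    show "p ++ q \<in> Q"
      using that by (auto simp: Q_def)
  qed
  have denseQ: "\<exists>p \<in> Q. \<forall>d \<in> cell P V p. \<exists>e. (e, c) \<in> P \<and> (e, d) \<in> P" if "c \<in> Field P" for c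
    using dense[OF that] by (auto simp: Q_def)
  have nonempty: "\<exists>c. c \<in> cell P V p" if "p \<in> Q" for p
    using indep[of p] that by (auto simp: Q_def)
  have cellF: "cell P V p \<subseteq> Field P" for p
    by (auto simp: cell_def)
  \<comment> \<open>A regular open set is recovered from the cells contained in it. In the other
    direction, below, a regular open set of Cohen conditions is sent to the regularised union of its
    cells.\<close>
  define h where "h U = {p \<in> Q. cell P V p \<subseteq> U}" for U
  have h_mem: "h U \<in> regular_opens ?T" if U: "U \<in> regular_opens ?S" for U
    unfolding roT
  proof (intro conjI ballI impI)
    show "h U \<subseteq> Q" by (auto simp: h_def)
    show "q \<in> h U" if "p \<in> h U" "q \<in> Q" "p \<subseteq>\<^sub>m q" for p q
      using that cell_mono by (auto simp: h_def)
    fix p assume p: "p \<in> Q" and *: "\<forall>q \<in> Q. p \<subseteq>\<^sub>m q \<longrightarrow> (\<exists>r \<in> h U. q \<subseteq>\<^sub>m r)"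
    have "c \<in> U" if c: "c \<in> cell P V p" for c
    proof (rule ccontr)
      assume "c \<notin> U"
      then obtain c' where c': "(c', c) \<in> P" "\<And>e. e \<in> U \<Longrightarrow> (e, c') \<notin> P"
        using U c unfolding roS cell_def by blast
      \<comment> \<open>The cell of \<open>q\<close> lies below \<open>c'\<close> up to
        regularisation and meets that of \<open>p\<close>. So \<open>q\<close> is compatible with
        \<open>p\<close>, and the hypothesis on \<open>p\<close> gives an extension \<open>r\<close>
        of \<open>q\<close> with its cell inside \<open>U\<close>, although nothing in
        \<open>U\<close> lies below \<open>c'\<close>.\<close>
      obtain q where q: "q \<in> Q" "\<forall>d \<in> cell P V q. \<exists>e. (e, c') \<in> P \<and> (e, d) \<in> P"
        using denseQ[of c'] c'(1) by (blast intro: FieldI1)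
      obtain d where "d \<in> cell P V q"
        using nonempty q(1) by blast
      then obtain e where e: "(e, c') \<in> P" "(e, d) \<in> P"
        using q(2) by blast
      then have "e \<in> cell P V p" "e \<in> cell P V q"
        using cell_down \<open>d \<in> cell P V q\<close> c c'(1) p q(1) trans by blast+
      then obtain s where s: "s \<in> Q" "p \<subseteq>\<^sub>m s" "q \<subseteq>\<^sub>m s"
        using compat p q(1) by blast
      then obtain r where r: "r \<in> Q" "cell P V r \<subseteq> U" "q \<subseteq>\<^sub>m r"
        using * unfolding h_def by (blast intro: map_le_trans)
      obtain d' where d': "d' \<in> cell P V r"
        using nonempty r(1) by blast
      then obtain e' where "(e', c') \<in> P" "(e', d') \<in> P"
        using q(2) cell_mono[OF r(3)] by blast
      with c'(2) cell_down[OF d' _ r(1)] r(2) show False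
        by blast
    qed
    with p show "p \<in> h U" by (auto simp: h_def)
  qed
  have h_le: "h U \<subseteq> h W \<longleftrightarrow> U \<subseteq> W" if U: "U \<in> regular_opens ?S" and W: "W \<in> regular_opens ?S" for U W
  proof
    assume hUW: "h U \<subseteq> h W"
    show "U \<subseteq> W"
    proof (rule ccontr)
      assume "\<not> U \<subseteq> W"
      then obtain c where c: "c \<in> U" "c \<notin> W" by blast
      then obtain c' where c': "(c', c) \<in> P" "\<And>e. e \<in> W \<Longrightarrow> (e, c') \<notin> P"
        using U W unfolding roS by blast
      have c'U: "c' \<in> U" using U c c'(1) unfolding roS by blast
      obtain p where p: "p \<in> Q" "\<forall>d \<in> cell P V p. \<exists>e. (e, c') \<in> P \<and> (e, d) \<in> P"
        using denseQ[of c'] c'(1) by (blast intro: FieldI1)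
      have "d \<in> U" if d: "d \<in> cell P V p" for d
      proof -
        have "\<exists>e \<in> U. (e, d') \<in> P" if "(d', d) \<in> P" for d'
          using p(2) cell_down[OF d that p(1)] c'U U unfolding roS by blast
        then show ?thesis
          using U d cellF unfolding roS by blast
      qed
      then have "p \<in> h U" using p(1) by (auto simp: h_def)
      then have W': "cell P V p \<subseteq> W" using hUW by (auto simp: h_def)
      obtain d where "d \<in> cell P V p" using nonempty p(1) by blast
      then obtain e where "(e, c') \<in> P" "(e, d) \<in> P" using p(2) by blast
      with c'(2) W' cell_down[OF \<open>d \<in> _\<close> _ p(1)] show False by blast
    qed
  qed (auto simp: h_def)
  have onto: "\<exists>U \<in> regular_opens ?S. h U = W" if W: "W \<in> regular_opens ?T" for W
  proof -
    define B where "B = (\<Union>p \<in> W. cell P V p)"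
    have WQ: "W \<subseteq> Q" using W unfolding roT by blast
    have B: "openin ?S B"
      unfolding openin_downset_topology
    proof (intro conjI ballI allI impI)
      show "B \<subseteq> Field P"
        using cellF unfolding B_def by blast
      fix c d assume "c \<in> B" "(d, c) \<in> P"
      then show "d \<in> B"
        using cell_down WQ unfolding B_def by blast
    qed
    define U where "U = ?S interior_of (?S closure_of B)"
    have Ueq: "U = {c \<in> Field P. \<forall>d. (d, c) \<in> P \<longrightarrow> (\<exists>e \<in> B. (e, d) \<in> P)}"
      unfolding U_def by (rule interior_closure_downset[OF P B])
    have "U \<in> regular_opens ?S"
      unfolding U_def by (rule regular_opens_interior_closure)
    moreover have "h U = W"
    proof (intro equalityI subsetI)
      fix p assume "p \<in> W"
      then have "cell P V p \<subseteq> B" by (auto simp: B_def)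
      moreover have "B \<subseteq> U"
        unfolding Ueq using B refl unfolding openin_downset_topology by (blast intro: FieldI1)
      ultimately show "p \<in> h U" using \<open>p \<in> W\<close> WQ by (auto simp: h_def)
    next
      fix p assume p: "p \<in> h U"
      show "p \<in> W"
      proof (rule ccontr)
        assume "p \<notin> W"
        then obtain q where q: "q \<in> Q" "p \<subseteq>\<^sub>m q" "\<And>r. r \<in> W \<Longrightarrow> \<not> q \<subseteq>\<^sub>m r"
          using W p unfolding roT h_def by blast
        obtain c where c: "c \<in> cell P V q" using nonempty q(1) by blast
        then have "c \<in> U" using cell_mono[OF q(2)] p by (auto simp: h_def)
        then obtain e where e: "e \<in> B" "(e, c) \<in> P" using refl unfolding Ueq by blast
        then obtain p' where p': "p' \<in> W" "e \<in> cell P V p'" by (auto simp: B_def)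
        obtain r where "r \<in> Q" "p' \<subseteq>\<^sub>m r" "q \<subseteq>\<^sub>m r"
          using compat[OF p'(2) cell_down[OF c e(2) q(1)]] p'(1) WQ q(1) by blast
        with q(3) p'(1) W show False unfolding roT by blast
      qed
    qed
    ultimately show ?thesis by blast
  qed
  have "bij_betw h (regular_opens ?S) (regular_opens ?T)"
    unfolding bij_betw_def
  proof
    show "inj_on h (regular_opens ?S)"
      by (rule inj_onI) (metis h_le subset_antisym subset_refl)
    show "h ` regular_opens ?S = regular_opens ?T"
      using h_mem onto by blast
  qed
  then show ?thesis
    unfolding forcing_equivalent_def using h_le by (rule ro_isomorphicI)
qed

section \<open>Countable forcings over a projection\<close>

text \<open>\<open>\<preceq>\<close> is extension of conditions on one countable stage, and
  \<open>\<preceq>\<^sub>J\<close> compares only their earlier parts, that is, what they say about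
  the structure known before that stage. \<open>projection\<close> says that passing to the earlier
  part is a projection of forcing notions; \<open>splitting\<close> says that the quotient has no
  atoms, as the two incompatible extensions have equivalent earlier parts.\<close>

locale countable_projection =
  fixes P :: "'p set"
    and le :: "'p \<Rightarrow> 'p \<Rightarrow> bool" (infix "\<preceq>" 50)
    and lej :: "'p \<Rightarrow> 'p \<Rightarrow> bool" (infix "\<preceq>\<^sub>J" 50)
  assumes countable_P: "countable P"
    and le_refl: "A \<in> P \<Longrightarrow> A \<preceq> A"
    and le_trans: "A \<preceq> B \<Longrightarrow> B \<preceq> C \<Longrightarrow> A \<preceq> C"
    and lej_trans: "A \<preceq>\<^sub>J B \<Longrightarrow> B \<preceq>\<^sub>J C \<Longrightarrow> A \<preceq>\<^sub>J C"
    and le_lej: "A \<preceq> B \<Longrightarrow> A \<preceq>\<^sub>J B"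
    and projection: "A \<in> P \<Longrightarrow> C \<in> P \<Longrightarrow> C \<preceq>\<^sub>J A \<Longrightarrow> \<exists>D \<in> P. D \<preceq> A \<and> D \<preceq>\<^sub>J C"
    and splitting: "A \<in> P \<Longrightarrow> \<exists>A0 \<in> P. \<exists>A1 \<in> P. A0 \<preceq> A \<and> A1 \<preceq> A \<and> A0 \<preceq>\<^sub>J A1 \<and> A1 \<preceq>\<^sub>J A0 \<and>
      \<not> (\<exists>B \<in> P. B \<preceq> A0 \<and> B \<preceq> A1)"
begin

section \<open>Queries, answers and recorded bits\<close>

definition query :: "nat \<Rightarrow> 'p" where
  "query = from_nat_into P"

lemma query_onto: "A \<in> P \<Longrightarrow> \<exists>i. query i = A"
  using from_nat_into_surj[OF countable_P] by (simp add: query_def)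

text \<open>The positive answer asks for \<open>A \<preceq> query i\<close> itself, not merely for
  compatibility of \<open>query i\<close> with every extension of \<open>A\<close>: density of the
  bits needs a condition that really lies below \<open>query i\<close>.\<close>

definition answers :: "'p \<Rightarrow> nat \<Rightarrow> bool \<Rightarrow> bool" where
  "answers A i b \<longleftrightarrow> (if b then A \<preceq> query i else \<not> (\<exists>B \<in> P. B \<preceq> A \<and> B \<preceq> query i))"

definition decides :: "(nat \<Rightarrow> bool) \<Rightarrow> nat \<Rightarrow> 'p set" where
  "decides t j = {A \<in> P. \<forall>i<j. answers A i (t i)}"

text \<open>
  Given a generic filter for \<open>\<preceq>\<^sub>J\<close> containing a condition of \<open>split t j\<close>, both answers to the query
  \<open>j\<close> are still possible after the answers \<open>t\<close> to the earlier queries.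
\<close>

definition split :: "(nat \<Rightarrow> bool) \<Rightarrow> nat \<Rightarrow> 'p set" where
  "split t j = {A \<in> P. \<forall>b. \<exists>B \<in> decides (t(j := b)) (Suc j). A \<preceq>\<^sub>J B}"

text \<open>The forcing negation of \<open>split\<close>, taken with respect to
  \<open>\<preceq>\<^sub>J\<close>, so that it too is a matter of the earlier part alone.\<close>

definition nonsplit :: "(nat \<Rightarrow> bool) \<Rightarrow> nat \<Rightarrow> 'p set" where
  "nonsplit t j = {A \<in> P. \<forall>B \<in> P. B \<preceq>\<^sub>J A \<longrightarrow> B \<notin> split t j}"

text \<open>If only the answers were settled, an extension could still turn a query of open status
  into a split one and shift all later positions in the list of bits. Settling the status of each
  query as well makes \<open>bits A t j\<close> final.\<close>

definition determined :: "(nat \<Rightarrow> bool) \<Rightarrow> nat \<Rightarrow> 'p set" where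
  "determined t j = {A \<in> decides t j. \<forall>i<j. A \<in> split t i \<union> nonsplit t i}"

definition bits :: "'p \<Rightarrow> (nat \<Rightarrow> bool) \<Rightarrow> nat \<Rightarrow> bool list" where
  "bits A t j = map t (filter (\<lambda>i. A \<in> split t i) [0..<j])"

text \<open>The query from which the \<open>k\<close>-th bit comes is not fixed: it depends on
  \<open>t\<close> and on the earlier part of \<open>A\<close>.\<close>

definition bit :: "nat \<Rightarrow> bool \<Rightarrow> 'p set" where
  "bit k b = {A. \<exists>t j. A \<in> determined t j \<and> k < length (bits A t j) \<and> bits A t j ! k = b}"

lemma answers_down: "A \<preceq> B \<Longrightarrow> answers B i b \<Longrightarrow> answers A i b"
  unfolding answers_def using le_trans by (smt (verit))

lemma answers_unique: "A \<in> P \<Longrightarrow> answers A i b \<Longrightarrow> answers A i c \<Longrightarrow> b = c"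
  unfolding answers_def using le_refl by (metis (full_types))

lemma answers_dense:
  assumes "A \<in> P"
  shows "\<exists>B \<in> P. \<exists>b. B \<preceq> A \<and> answers B i b"
proof (cases "\<exists>B \<in> P. B \<preceq> A \<and> B \<preceq> query i")
  case True
  then show ?thesis by (auto simp: answers_def)
next
  case False
  then have "answers A i False" by (simp add: answers_def)
  then show ?thesis using assms le_refl by blast
qed

lemma decides_down: "A \<in> P \<Longrightarrow> A \<preceq> B \<Longrightarrow> B \<in> decides t j \<Longrightarrow> A \<in> decides t j"
  unfolding decides_def using answers_down by blast

lemma decides_cong: "(\<And>i. i < j \<Longrightarrow> t i = t' i) \<Longrightarrow> decides t j = decides t' j"
  unfolding decides_def by auto

lemma split_cong:
  assumes "\<And>i. i < j \<Longrightarrow> t i = t' i"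
  shows "split t j = split t' j"
proof -
  have "decides (t(j := b)) (Suc j) = decides (t'(j := b)) (Suc j)" for b
    by (rule decides_cong) (use assms less_Suc_eq in auto)
  then show ?thesis by (simp add: split_def)
qed

lemma split_down: "A \<in> P \<Longrightarrow> A \<preceq>\<^sub>J B \<Longrightarrow> B \<in> split t j \<Longrightarrow> A \<in> split t j"
  unfolding split_def using lej_trans by blast

lemma nonsplit_down: "A \<in> P \<Longrightarrow> A \<preceq>\<^sub>J B \<Longrightarrow> B \<in> nonsplit t j \<Longrightarrow> A \<in> nonsplit t j"
  unfolding nonsplit_def using lej_trans by blast

lemma split_nonsplit_disjoint: "A \<in> split t j \<Longrightarrow> A \<notin> nonsplit t j"
  unfolding nonsplit_def using le_lej le_refl by blast

lemma split_or_nonsplit_down: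
  assumes "A \<in> P" "A \<preceq>\<^sub>J B" "B \<in> split t j \<union> nonsplit t j"
  shows "A \<in> split t j \<longleftrightarrow> B \<in> split t j" "A \<in> split t j \<union> nonsplit t j"
proof -
  show "A \<in> split t j \<longleftrightarrow> B \<in> split t j"
    using assms split_down[of A B] nonsplit_down[of A B] split_nonsplit_disjoint[of A] by blast
  show "A \<in> split t j \<union> nonsplit t j"
    using assms split_down[of A B] nonsplit_down[of A B] by blast
qed

lemma determined_down: "A \<in> P \<Longrightarrow> A \<preceq> B \<Longrightarrow> B \<in> determined t j \<Longrightarrow> A \<in> determined t j"
  unfolding determined_def using decides_down split_or_nonsplit_down(2) le_lej by blast

lemma determined_cong:
  assumes "\<And>i. i < j \<Longrightarrow> t i = t' i"
  shows "determined t j = determined t' j"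
proof -
  have "split t i = split t' i" if "i < j" for i
    using assms that by (intro split_cong) auto
  moreover have "decides t j = decides t' j"
    using assms by (rule decides_cong)
  ultimately show ?thesis by (auto simp: determined_def nonsplit_def)
qed

lemma determined_antimono: "i \<le> j \<Longrightarrow> determined t j \<subseteq> determined t i"
  unfolding determined_def decides_def by (auto dest: order.strict_trans2)

lemma determined_in_P: "A \<in> determined t j \<Longrightarrow> A \<in> P"
  by (simp add: determined_def decides_def)

lemma determined_unique:
  assumes "A \<in> determined t i" "A \<in> determined t' j" "l < i" "l < j"
  shows "t l = t' l"
proof (rule answers_unique)
  show "A \<in> P" "answers A l (t l)" "answers A l (t' l)"
    using assms by (simp_all add: determined_def decides_def)
qed

lemma determined_dense:
  assumes "A \<in> P"
  shows "\<exists>B \<in> P. \<exists>t. B \<preceq> A \<and> B \<in> determined t j"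
proof (induction j)
  case 0
  have "A \<in> determined t 0" for t
    using assms by (simp add: determined_def decides_def)
  then show ?case using assms le_refl by blast
next
  case (Suc j)
  then obtain B t where B: "B \<in> P" "B \<preceq> A" "B \<in> determined t j" by blast
  obtain C where C: "C \<in> P" "C \<preceq> B" "C \<in> split t j \<union> nonsplit t j"
  proof (cases "B \<in> nonsplit t j")
    case True
    then show ?thesis using that B le_refl by blast
  next
    case False
    then obtain B' where B': "B' \<in> P" "B' \<preceq>\<^sub>J B" "B' \<in> split t j"
      using B(1) unfolding nonsplit_def by blast
    \<comment> \<open>\<open>B'\<close> lies below \<open>B\<close> only in its earlier part. The
      projection property gives a genuine extension of \<open>B\<close>, and \<open>split\<close> is
      inherited along \<open>\<preceq>\<^sub>J\<close>.\<close>
    then obtain C where "C \<in> P" "C \<preceq> B" "C \<preceq>\<^sub>J B'"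
      using projection B(1) by blast
    then show ?thesis using that B' split_down by blast
  qed
  obtain D b where D: "D \<in> P" "D \<preceq> C" "answers D j b"
    using answers_dense[OF C(1)] by blast
  have "D \<in> determined t j"
    using determined_down B(3) C(2) D(1,2) le_trans by blast
  \<comment> \<open>The status of query \<open>j\<close> depends only on the answers before
    \<open>j\<close>, so the value of \<open>t\<close> at \<open>j\<close> may be set
    afterwards.\<close>
  then have "D \<in> determined (t(j := b)) j"
    by (subst determined_cong[of j _ t]) auto
  moreover have "D \<in> split (t(j := b)) j \<union> nonsplit (t(j := b)) j"
    using split_or_nonsplit_down(2)[OF D(1) le_lej[OF D(2)] C(3)] split_cong[of j "t(j := b)" t]
    by (simp add: nonsplit_def)
  ultimately have "D \<in> determined (t(j := b)) (Suc j)"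
    using D(3) unfolding determined_def decides_def by (auto simp: less_Suc_eq)
  moreover have "D \<preceq> A"
    using D(2) C(2) B(2) le_trans by blast
  ultimately show ?case using D(1) by blast
qed

lemma bits_Suc: "bits A t (Suc j) = bits A t j @ (if A \<in> split t j then [t j] else [])"
  by (simp add: bits_def)

lemma bits_prefix: "i \<le> j \<Longrightarrow> \<exists>xs. bits A t j = bits A t i @ xs"
  by (induction j rule: dec_induct) (auto simp: bits_Suc)

lemma bits_nth_mono:
  assumes "i \<le> j" "k < length (bits A t i)"
  shows "k < length (bits A t j)" "bits A t j ! k = bits A t i ! k"
proof -
  obtain xs where "bits A t j = bits A t i @ xs"
    using bits_prefix[OF assms(1)] by blast
  then show "k < length (bits A t j)" "bits A t j ! k = bits A t i ! k"
    using assms(2) by (simp_all add: nth_append)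
qed

lemma bits_cong:
  assumes "\<And>i. i < j \<Longrightarrow> t i = t' i" "\<And>i. i < j \<Longrightarrow> A \<in> split t i \<longleftrightarrow> B \<in> split t i"
  shows "bits A t j = bits B t' j"
proof -
  have "split t i = split t' i" if "i < j" for i
    using assms(1) that by (intro split_cong) auto
  then have "filter (\<lambda>i. A \<in> split t i) [0..<j] = filter (\<lambda>i. B \<in> split t' i) [0..<j]"
    using assms(2) by (intro filter_cong) auto
  then show ?thesis
    unfolding bits_def using assms(1) by (intro map_cong) auto
qed

text \<open>Here \<open>\<preceq>\<^sub>J\<close> suffices: for a fixed run \<open>t\<close> of
  answers the list depends only on which queries are split, and a settled status is inherited along
  \<open>\<preceq>\<^sub>J\<close>.\<close>

lemma bits_down:
  assumes "A \<in> P" "A \<preceq>\<^sub>J B" "B \<in> determined t j"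
  shows "bits A t j = bits B t j"
proof (rule bits_cong)
  show "A \<in> split t i \<longleftrightarrow> B \<in> split t i" if "i < j" for i
    using assms(3) that by (intro split_or_nonsplit_down(1)[OF assms(1,2)]) (simp add: determined_def)
qed simp

lemma bits_unique:
  assumes "A \<in> determined t j" "A \<in> determined t' j"
  shows "bits A t j = bits A t' j"
proof (rule bits_cong)
  show "t i = t' i" if "i < j" for i
    using determined_unique[OF assms that that] .
qed simp

lemma bit_down:
  assumes "A \<in> P" "A \<preceq> B" "B \<in> bit k b"
  shows "A \<in> bit k b"
proof -
  obtain t j where B: "B \<in> determined t j" "k < length (bits B t j)" "bits B t j ! k = b"
    using assms(3) unfolding bit_def by blast
  then show ?thesis
    using determined_down[OF assms(1,2) B(1)] bits_down[OF assms(1) le_lej[OF assms(2)] B(1)]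
    unfolding bit_def by (intro CollectI exI[of _ t] exI[of _ j]) simp
qed

text \<open>Two runs settled by the same condition coincide as far as both go, and a longer run only
  appends bits.\<close>

lemma bit_nth:
  assumes "A \<in> determined t j" "A \<in> bit k b" "k < length (bits A t j)"
  shows "bits A t j ! k = b"
proof -
  obtain t' i where i: "A \<in> determined t' i" "k < length (bits A t' i)" "bits A t' i ! k = b"
    using assms(2) unfolding bit_def by blast
  let ?m = "min i j"
  have "A \<in> determined t ?m" "A \<in> determined t' ?m"
    using assms(1) i(1) determined_antimono[of ?m j t] determined_antimono[of ?m i t'] by auto
  then have eq: "bits A t ?m = bits A t' ?m"
    by (rule bits_unique)
  show ?thesis
  proof (cases "i \<le> j")
    case True
    then show ?thesis
      using eq i bits_nth_mono[of i j k A t] by (simp add: min_def)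
  next
    case False
    then show ?thesis
      using eq i assms(3) bits_nth_mono[of j i k A t'] by (simp add: min_def)
  qed
qed

lemma bit_disjoint: "bit k True \<inter> bit k False = {}"
proof -
  have False if A: "A \<in> bit k True" "A \<in> bit k False" for A
  proof -
    obtain t j where "A \<in> determined t j" "k < length (bits A t j)" "bits A t j ! k = True"
      using A(1) unfolding bit_def by blast
    then show False
      using bit_nth[OF _ A(2)] by blast
  qed
  then show ?thesis by blast
qed

section \<open>Independence and density of the bits of one stage\<close>

text \<open>Both answers to query \<open>l\<close> are possible over the earlier part of
  \<open>B\<close>: \<open>B\<close> itself gives one, and \<open>A\<close>, whose earlier part is
  weaker, gives the other after the same answers to the queries before \<open>l\<close>.\<close>

lemma split_first_difference:
  assumes A: "A \<in> determined t i" and B: "B \<in> determined t' j" and AB: "B \<preceq>\<^sub>J A"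
    and l: "l < i" "l < j" "t l \<noteq> t' l" "\<And>k. k < l \<Longrightarrow> t k = t' k"
  shows "B \<in> split t' l"
proof -
  have "\<exists>C \<in> decides (t'(l := b)) (Suc l). B \<preceq>\<^sub>J C" for b
  proof (cases "b = t' l")
    case True
    have "B \<in> decides t' (Suc l)"
      using B l(2) unfolding determined_def decides_def by auto
    with True show ?thesis
      using le_lej le_refl determined_in_P[OF B] by auto
  next
    case False
    have "A \<in> decides t (Suc l)"
      using A l(1) unfolding determined_def decides_def by auto
    moreover have "decides t (Suc l) = decides (t'(l := b)) (Suc l)"
      by (rule decides_cong) (use False l in \<open>auto simp: less_Suc_eq\<close>)
    ultimately show ?thesis using AB by blast
  qed
  then show ?thesis
    using determined_in_P[OF B] by (simp add: split_def)
qed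

text \<open>
  Two incompatible, \<open>\<preceq>\<^sub>J\<close>-equivalent extensions give different answers to some query, so that a split
  query comes up sooner or later; by the projection property its answer can be chosen freely.
\<close>

lemma next_bit:
  assumes A: "A \<in> determined t j"
  shows "\<exists>B t' l. B \<preceq>\<^sub>J A \<and> B \<in> determined t' l \<and> bits B t' l = bits A t j @ [b]"
proof -
  have AP: "A \<in> P" using A by (rule determined_in_P)
  obtain A0 A1 where A01: "A0 \<in> P" "A1 \<in> P" "A0 \<preceq> A" "A1 \<preceq> A" "A0 \<preceq>\<^sub>J A1" "A1 \<preceq>\<^sub>J A0"
    and inc: "\<not> (\<exists>B \<in> P. B \<preceq> A0 \<and> B \<preceq> A1)"
    using splitting[OF AP] by blast
  obtain i where i: "query i = A0" using query_onto A01(1) by blast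
  \<comment> \<open>Far enough to include query \<open>i\<close>, which separates \<open>A0\<close>
    from \<open>A1\<close>, and the \<open>j\<close> queries already settled by
    \<open>A\<close>.\<close>
  define m where "m = max (Suc i) j"
  obtain B0 t0 where B0: "B0 \<in> P" "B0 \<preceq> A0" "B0 \<in> determined t0 m"
    using determined_dense[OF A01(1)] by blast
  \<comment> \<open>The equivalence of the earlier parts of \<open>A0\<close> and \<open>A1\<close>
    is used here: what \<open>B0\<close> says about the past can be added to
    \<open>A1\<close>.\<close>
  have "B0 \<preceq>\<^sub>J A1" using B0(2) A01(5) le_lej lej_trans by blast
  then obtain C1 where C1: "C1 \<in> P" "C1 \<preceq> A1" "C1 \<preceq>\<^sub>J B0"
    using projection A01(2) B0(1) by blast
  obtain B1 t1 where B1: "B1 \<in> P" "B1 \<preceq> C1" "B1 \<in> determined t1 m"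
    using determined_dense[OF C1(1)] by blast
  have B10: "B1 \<preceq>\<^sub>J B0" using B1(2) C1(3) le_lej lej_trans by blast
  have B1A: "B1 \<preceq> A" using B1(2) C1(2) A01(4) le_trans by blast
  have B0A: "B0 \<preceq> A" using B0(2) A01(3) le_trans by blast
  have tj: "t0 k = t k" "t1 k = t k" if "k < j" for k
  proof -
    have "k < m" using that by (simp add: m_def)
    then show "t0 k = t k" "t1 k = t k"
      using determined_unique[OF B0(3) determined_down[OF B0(1) B0A A]]
        determined_unique[OF B1(3) determined_down[OF B1(1) B1A A]] that by blast+
  qed
  have "i < m" by (simp add: m_def)
  have "answers B0 i True" using B0(2) i by (simp add: answers_def)
  moreover have "answers B0 i (t0 i)"
    using B0(3) \<open>i < m\<close> by (simp add: determined_def decides_def)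
  ultimately have "t0 i"
    using answers_unique[OF B0(1)] by blast
  moreover have "\<not> t1 i"
  proof
    assume "t1 i"
    moreover have "answers B1 i (t1 i)"
      using B1(3) \<open>i < m\<close> by (simp add: determined_def decides_def)
    ultimately have "B1 \<preceq> A0"
      using i by (simp add: answers_def)
    moreover have "B1 \<preceq> A1" using B1(2) C1(2) le_trans by blast
    ultimately show False using inc B1(1) by blast
  qed
  ultimately have "t0 i \<noteq> t1 i" by simp
  then have "\<exists>l. t0 l \<noteq> t1 l" by blast
  then obtain l where l: "t0 l \<noteq> t1 l" "\<And>k. k < l \<Longrightarrow> t0 k = t1 k"
    unfolding exists_least_iff[of "\<lambda>l. t0 l \<noteq> t1 l"] by blast
  have "l \<le> i" using l(2) \<open>t0 i \<noteq> t1 i\<close> not_less by blast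
  then have lm: "l < m" by (simp add: m_def)
  have "j \<le> l" using l(1) tj not_less by metis
  have "B1 \<in> split t1 l"
    using split_first_difference[OF B0(3) B1(3) B10] lm l by blast
  then have "\<exists>n \<ge> j. n < m \<and> B1 \<in> split t1 n" using \<open>j \<le> l\<close> lm by blast
  \<comment> \<open>At the first split query from \<open>j\<close> on exactly one bit is recorded
    beyond those of \<open>A\<close>; the queries in between add none.\<close>
  then obtain n where n: "j \<le> n" "n < m" "B1 \<in> split t1 n"
    and least: "\<And>k. j \<le> k \<Longrightarrow> k < n \<Longrightarrow> B1 \<notin> split t1 k"
    unfolding exists_least_iff[of "\<lambda>n. j \<le> n \<and> n < m \<and> B1 \<in> split t1 n"]
    by (blast dest: order.strict_trans)
  have "bits B1 t1 n' = bits A t j" if "j \<le> n'" "n' \<le> n" for n'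
    using that
  proof (induction n' rule: dec_induct)
    case base
    have "bits B1 t1 j = bits B1 t j"
      by (rule bits_cong) (auto simp: tj)
    then show ?case using bits_down[OF B1(1) le_lej[OF B1A] A] by simp
  next
    case (step n')
    then show ?case using least by (simp add: bits_Suc)
  qed
  then have bits1: "bits B1 t1 n = bits A t j" using n(1) by blast
  \<comment> \<open>\<open>C\<close> gives the same answers as \<open>B1\<close> before
    \<open>n\<close> and the desired answer \<open>b\<close> at \<open>n\<close>. Extending it to a
    condition with earlier part below that of \<open>B1\<close> keeps the status of all queries up
    to \<open>n\<close>.\<close>
  obtain C where C: "C \<in> decides (t1(n := b)) (Suc n)" "B1 \<preceq>\<^sub>J C"
    using n(3) unfolding split_def by blast
  have CP: "C \<in> P" using C(1) by (simp add: decides_def)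
  obtain B where B: "B \<in> P" "B \<preceq> C" "B \<preceq>\<^sub>J B1"
    using projection[OF CP B1(1) C(2)] by blast
  have eq: "split (t1(n := b)) k = split t1 k" if "k \<le> n" for k
    using that by (intro split_cong) auto
  have st: "B1 \<in> split t1 k \<union> nonsplit t1 k" if "k < m" for k
    using B1(3) that unfolding determined_def by blast
  have "B \<in> decides (t1(n := b)) (Suc n)"
    using decides_down[OF B(1,2) C(1)] .
  moreover have "B \<in> split (t1(n := b)) k \<union> nonsplit (t1(n := b)) k" if "k < Suc n" for k
    using split_or_nonsplit_down(2)[OF B(1,3) st[of k]] eq[of k] that n(2) by (simp add: nonsplit_def)
  ultimately have det: "B \<in> determined (t1(n := b)) (Suc n)"
    by (simp add: determined_def)
  have iff: "B \<in> split t1 k \<longleftrightarrow> B1 \<in> split t1 k" if "k < m" for k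
    using split_or_nonsplit_down(1)[OF B(1,3) st[OF that]] .
  have "bits B (t1(n := b)) n = bits B1 t1 n"
    using iff n(2) eq by (intro bits_cong) auto
  then have "bits B (t1(n := b)) (Suc n) = bits A t j @ [b]"
    using iff[OF n(2)] n(3) eq[of n] bits1 by (simp add: bits_Suc)
  moreover have "B \<preceq>\<^sub>J A" using B(3) B1A le_lej lej_trans by blast
  ultimately show ?thesis using det by blast
qed

text \<open>Only the earlier part of \<open>C\<close> is kept, since \<open>C\<close> itself may
  already have fixed bits contrary to \<open>\<sigma>\<close>. So any finite pattern is possible
  over any information about the past.\<close>

lemma bits_independent:
  assumes "C \<in> P"
  shows "\<exists>A t j. A \<preceq>\<^sub>J C \<and> A \<in> determined t j \<and> bits A t j = \<sigma>"
proof (induction \<sigma> rule: rev_induct)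
  case Nil
  have "C \<in> determined t 0" "bits C t 0 = []" for t
    using assms by (simp_all add: determined_def decides_def bits_def)
  then show ?case using le_lej le_refl assms by blast
next
  case (snoc b \<sigma>)
  then show ?case using next_bit lej_trans by metis
qed

lemma bit_independent:
  assumes "C \<in> P"
  shows "\<exists>A \<in> P. A \<preceq>\<^sub>J C \<and> (\<forall>k<length \<sigma>. A \<in> bit k (\<sigma> ! k))"
proof -
  obtain A t j where A: "A \<preceq>\<^sub>J C" "A \<in> determined t j" "bits A t j = \<sigma>"
    using bits_independent[OF assms] by blast
  then have "A \<in> bit k (\<sigma> ! k)" if "k < length \<sigma>" for k
    using that unfolding bit_def by blast
  with A determined_in_P show ?thesis by blast
qed

text \<open>Let \<open>A\<close> be query \<open>i\<close>, and let \<open>A'\<close> settle the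
  queries up to \<open>i\<close>. If \<open>C\<close> has the bits of \<open>A'\<close> and an
  earlier part below that of \<open>A'\<close>, an extension of \<open>C\<close> that settles these
  queries gives the same answers: at the first difference the query would be split, so its answer
  would be one of the recorded bits. Hence query \<open>i\<close> is answered positively, which puts
  this extension below \<open>A\<close>.\<close>

lemma bit_dense:
  assumes A: "A \<in> P"
  shows "\<exists>A' \<in> P. A' \<preceq> A \<and> (\<exists>\<sigma>. \<forall>C \<in> P. C \<preceq>\<^sub>J A' \<longrightarrow> (\<forall>k<length \<sigma>. C \<in> bit k (\<sigma> ! k)) \<longrightarrow>
    (\<exists>D \<in> P. D \<preceq> C \<and> D \<preceq> A))"
proof -
  obtain i where i: "query i = A" using query_onto A by blast
  obtain A' t where A': "A' \<in> P" "A' \<preceq> A" "A' \<in> determined t (Suc i)"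
    using determined_dense[OF A] by blast
  define \<sigma> where "\<sigma> = bits A' t (Suc i)"
  have "answers A' i True" using A'(2) i by (simp add: answers_def)
  moreover have "answers A' i (t i)"
    using A'(3) by (simp add: determined_def decides_def)
  ultimately have "t i"
    using answers_unique[OF A'(1)] by blast
  have "\<exists>D \<in> P. D \<preceq> C \<and> D \<preceq> A"
    if C: "C \<in> P" "C \<preceq>\<^sub>J A'" "\<forall>k<length \<sigma>. C \<in> bit k (\<sigma> ! k)" for C
  proof -
    obtain D t' where D: "D \<in> P" "D \<preceq> C" "D \<in> determined t' (Suc i)"
      using determined_dense[OF C(1)] by blast
    have DA': "D \<preceq>\<^sub>J A'" using D(2) C(2) le_lej lej_trans by blast
    have "t l = t' l" if "l \<le> i" for l
      using that
    proof (induction l rule: less_induct)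
      case (less l)
      show ?case
      proof (rule ccontr)
        assume neq: "t l \<noteq> t' l"
        have eq: "t k = t' k" if "k < l" for k using less that by simp
        have seq: "split t k = split t' k" if "k \<le> l" for k
          using that eq by (intro split_cong) auto
        have "D \<in> split t' l"
          using split_first_difference[OF A'(3) D(3) DA' _ _ neq eq] less.prems by simp
        have iff: "D \<in> split t k \<longleftrightarrow> A' \<in> split t k" if "k \<le> l" for k
          using split_or_nonsplit_down(1)[OF D(1) DA', of t k] A'(3) less.prems that
          unfolding determined_def by simp
        let ?k = "length (bits A' t l)"
        have "A' \<in> split t l" using iff[of l] seq[of l] \<open>D \<in> split t' l\<close> by simp
        then have A'l: "bits A' t (Suc l) = bits A' t l @ [t l]"
          by (simp add: bits_Suc)
        then have k: "?k < length \<sigma>" "\<sigma> ! ?k = t l"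
          unfolding \<sigma>_def using bits_nth_mono[of "Suc l" "Suc i" ?k A' t] less.prems by simp_all
        have "bits D t' l = bits A' t l"
          using iff seq eq by (intro bits_cong) auto
        then have Dl: "bits D t' (Suc l) = bits A' t l @ [t' l]"
          using \<open>D \<in> split t' l\<close> by (simp add: bits_Suc)
        have "D \<in> determined t' (Suc l)"
          using D(3) determined_antimono[of "Suc l" "Suc i" t'] less.prems by auto
        moreover have "D \<in> bit ?k (t l)"
        proof -
          have "C \<in> bit ?k (\<sigma> ! ?k)" using C(3) k(1) by blast
          then show ?thesis using bit_down[OF D(1,2)] k(2) by simp
        qed
        ultimately have "bits D t' (Suc l) ! ?k = t l"
          by (rule bit_nth) (simp add: Dl)
        with Dl neq show False by simp
      qed
    qed
    then have "t' i" using \<open>t i\<close> by simp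
    then have "D \<preceq> A"
      using D(3) i unfolding determined_def decides_def answers_def by (metis (mono_tags, lifting) lessI mem_Collect_eq)
    then show ?thesis using D by blast
  qed
  then show ?thesis using A' by blast
qed

theorem independent_bits:
  "\<exists>U :: nat \<Rightarrow> bool \<Rightarrow> 'p set.
    (\<forall>k b A B. A \<in> P \<longrightarrow> A \<preceq> B \<longrightarrow> B \<in> U k b \<longrightarrow> A \<in> U k b) \<and>
    (\<forall>k. U k True \<inter> U k False = {}) \<and>
    (\<forall>C \<in> P. \<forall>\<sigma>. \<exists>A \<in> P. A \<preceq>\<^sub>J C \<and> (\<forall>k<length \<sigma>. A \<in> U k (\<sigma> ! k))) \<and>
    (\<forall>A \<in> P. \<exists>A' \<in> P. A' \<preceq> A \<and> (\<exists>\<sigma>. \<forall>C \<in> P. C \<preceq>\<^sub>J A' \<longrightarrow> (\<forall>k<length \<sigma>. C \<in> U k (\<sigma> ! k)) \<longrightarrow>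
      (\<exists>D \<in> P. D \<preceq> C \<and> D \<preceq> A)))"
  by (rule exI[of _ bit], intro conjI allI impI ballI)
    (erule (2) bit_down, rule bit_disjoint, erule bit_independent, erule bit_dense)

end

section \<open>Covering a set by countable pieces\<close>

context
  includes cardinal_syntax
begin

section \<open>Well-founded relations and comparison with the alephs\<close>

text \<open>On a finite set a well-founded relation is finite and acyclic, hence conversely
  well-founded. This picks the last of finitely many stages or blocks.\<close>

lemma finite_max_wf:
  assumes "wf r" "finite A" "A \<noteq> {}"
  obtains z where "z \<in> A" "\<And>y. (z, y) \<in> r \<Longrightarrow> y \<notin> A"
proof -
  have "acyclic r"
    using assms(1) by (rule wf_acyclic)
  then have "wf ((r \<inter> A \<times> A)\<inverse>)"
    using assms(2) by (intro finite_acyclic_wf_converse) (auto intro: acyclic_subset)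
  then obtain z where "z \<in> A" "\<And>y. (y, z) \<in> (r \<inter> A \<times> A)\<inverse> \<Longrightarrow> y \<notin> A"
    using wfE_min'[of _ A] assms(3) by blast
  then show ?thesis
    using that by blast
qed

lemma is_aleph_Card_order: "is_aleph n r \<Longrightarrow> Card_order r"
proof (induction n arbitrary: r)
  case 0
  then show ?case
    using natLeq_Card_order by (auto intro: Card_order_ordIso)
next
  case (Suc n)
  then obtain s :: "'a rel" where "is_aleph n s" "r =o cardSuc s"
    by auto
  with Suc.IH show ?case
    using cardSuc_Card_order Card_order_ordIso by blast
qed

lemma aleph_le_0: "infinite X \<Longrightarrow> aleph_le 0 X"
proof -
  assume "infinite X"
  then obtain f :: "nat \<Rightarrow> 'a" where f: "inj f" "range f \<subseteq> X"
    unfolding infinite_iff_countable_subset by blast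
  have "|range f| =o |UNIV :: nat set|"
    using f(1) card_of_ordIso[of UNIV "range f"] by (auto simp: bij_betw_def intro: ordIso_symmetric)
  then have "|range f| =o natLeq"
    using card_of_nat ordIso_transitive by blast
  moreover have "|range f| \<le>o |X|"
    using f(2) by (rule card_of_mono1)
  ultimately show ?thesis
    unfolding aleph_le_def by auto
qed

text \<open>\<open>cardSuc r\<close> lives on the larger type \<open>'a set\<close>, while
  \<open>is_aleph\<close> needs a copy of it over \<open>'a\<close>: the cardinal of an equipotent
  subset of \<open>X\<close> serves.\<close>

lemma aleph_le_Suc:
  fixes V X :: "'a set"
  assumes "aleph_le n V" "|V| <o |X|"
  shows "aleph_le (Suc n) X"
proof -
  obtain r :: "'a rel" where r: "is_aleph n r" "r \<le>o |V|"
    using assms(1) unfolding aleph_le_def by blast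
  have cr: "Card_order r"
    using r(1) by (rule is_aleph_Card_order)
  have "r <o |X|"
    using r(2) assms(2) by (rule ordLeq_ordLess_trans)
  then have le: "cardSuc r \<le>o |X|"
    using cardSuc_ordLess_ordLeq[OF cr card_of_Card_order] by blast
  have eq: "|Field (cardSuc r)| =o cardSuc r"
    by (simp add: cr cardSuc_Card_order card_of_Field_ordIso)
  then have "|Field (cardSuc r)| \<le>o |X|"
    using le ordIso_ordLeq_trans by blast
  then obtain B where B: "B \<subseteq> X" "|Field (cardSuc r)| =o |B|" "|B| \<le>o |X|"
    using internalize_card_of_ordLeq2[THEN iffD1] by blast
  have "|B| =o cardSuc r"
    using B(2) eq ordIso_symmetric ordIso_transitive by blast
  then have "is_aleph (Suc n) |B|"
    using r(1) by auto
  then show ?thesis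
    using B(3) unfolding aleph_le_def by blast
qed

text \<open>
  The sets \<open>Y a\<close> play the role of the traces on \<open>X\<close> of the countable models of a Davies tree: the
  finite sets covered before stage \<open>a\<close> are the finite subsets of finitely many sets.
\<close>

definition covering_system :: "'a set \<Rightarrow> 'a set \<Rightarrow> 'a rel \<Rightarrow> ('a \<Rightarrow> 'a set) \<Rightarrow> bool" where
  "covering_system X I R Y \<longleftrightarrow>
     I \<subseteq> X \<and> wf R \<and> trans R \<and> total_on I R \<and>
     (\<forall>a \<in> I. countable (Y a) \<and> Y a \<subseteq> X \<and> infinite (Y a - (\<Union>b \<in> {b \<in> I. (b, a) \<in> R}. Y b))) \<and>
     (\<forall>s. finite s \<longrightarrow> s \<subseteq> X \<longrightarrow> (\<exists>a \<in> I. s \<subseteq> Y a)) \<and>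
     (\<forall>a \<in> I. \<exists>m Z. aleph_le m X \<and> (\<forall>s. finite s \<longrightarrow> s \<noteq> {} \<longrightarrow>
       ((\<exists>b \<in> I. (b, a) \<in> R \<and> s \<subseteq> Y b) \<longleftrightarrow> (\<exists>i<m. s \<subseteq> Z i))))"

lemma covering_systemD:
  assumes "covering_system X I R Y"
  shows "I \<subseteq> X" "wf R" "trans R" "total_on I R"
    "a \<in> I \<Longrightarrow> countable (Y a)" "a \<in> I \<Longrightarrow> Y a \<subseteq> X"
    "a \<in> I \<Longrightarrow> infinite (Y a - (\<Union>b \<in> {b \<in> I. (b, a) \<in> R}. Y b))"
    "finite s \<Longrightarrow> s \<subseteq> X \<Longrightarrow> \<exists>a \<in> I. s \<subseteq> Y a"
    "a \<in> I \<Longrightarrow> \<exists>m Z. aleph_le m X \<and> (\<forall>s. finite s \<longrightarrow> s \<noteq> {} \<longrightarrow>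
       ((\<exists>b \<in> I. (b, a) \<in> R \<and> s \<subseteq> Y b) \<longleftrightarrow> (\<exists>i<m. s \<subseteq> Z i)))"
proof -
  note D = assms[unfolded covering_system_def]
  show "I \<subseteq> X" using D by (elim conjE)
  show "wf R" using D by (elim conjE)
  show "trans R" using D by (elim conjE)
  show "total_on I R" using D by (elim conjE)
  have Y: "\<forall>a \<in> I. countable (Y a) \<and> Y a \<subseteq> X \<and> infinite (Y a - (\<Union>b \<in> {b \<in> I. (b, a) \<in> R}. Y b))"
    using D by (elim conjE)
  show "countable (Y a)" "Y a \<subseteq> X" "infinite (Y a - (\<Union>b \<in> {b \<in> I. (b, a) \<in> R}. Y b))" if "a \<in> I"
    using bspec[OF Y that] by blast+
  have "\<forall>s. finite s \<longrightarrow> s \<subseteq> X \<longrightarrow> (\<exists>a \<in> I. s \<subseteq> Y a)"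
    using D by (elim conjE)
  then show "\<exists>a \<in> I. s \<subseteq> Y a" if "finite s" "s \<subseteq> X"
    using that by blast
  have Z: "\<forall>a \<in> I. \<exists>m Z. aleph_le m X \<and> (\<forall>s. finite s \<longrightarrow> s \<noteq> {} \<longrightarrow>
      ((\<exists>b \<in> I. (b, a) \<in> R \<and> s \<subseteq> Y b) \<longleftrightarrow> (\<exists>i<m. s \<subseteq> Z i)))"
    using D by (elim conjE)
  show "\<exists>m Z. aleph_le m X \<and> (\<forall>s. finite s \<longrightarrow> s \<noteq> {} \<longrightarrow>
      ((\<exists>b \<in> I. (b, a) \<in> R \<and> s \<subseteq> Y b) \<longleftrightarrow> (\<exists>i<m. s \<subseteq> Z i)))" if "a \<in> I"
    using bspec[OF Z that] .
qed

text \<open>A single stage without predecessors, whence \<open>m = 0\<close>.\<close>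

lemma covering_system_countable:
  assumes "infinite X" "countable X"
  shows "\<exists>I R Y. covering_system X I R Y"
proof -
  obtain x where "x \<in> X"
    using assms(1) by fastforce
  then have "covering_system X {x} {} (\<lambda>_. X)"
    unfolding covering_system_def using assms aleph_le_0
    by (auto simp: total_on_def intro!: exI[of _ "0 :: nat"])
  then show ?thesis by blast
qed

section \<open>Blocks and the inductive construction of covering systems\<close>

text \<open>The block with index \<open>\<xi>\<close> gets as many points as \<open>\<xi>\<close>
  has predecessors in a minimal well-order of \<open>X\<close>, plus countably many. It is then
  smaller than \<open>X\<close>, yet has room for an injective copy of the union of all preceding
  blocks; this allows a covering of one block to be extended to everything before it.\<close>

lemma block_decomposition:
  fixes X :: "'a set"
  assumes "uncountable X"
  obtains c V where "\<forall>x \<in> X. c x \<in> X"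
    and "\<forall>\<xi> \<in> X. V \<xi> = {x \<in> X. c x = \<xi>}"
    and "\<forall>\<xi> \<in> X. infinite (V \<xi>)"
    and "\<forall>\<xi> \<in> X. |V \<xi>| <o |X|"
    and "\<forall>\<xi> \<in> X. |\<Union> (V ` underS |X| \<xi>)| \<le>o |V \<xi>|"
proof -
  let ?r = "|X|"
  define S where "S \<xi> = underS ?r \<xi> <+> (UNIV :: nat set)" for \<xi>
  have inf: "infinite X" using assms by (rule uncountable_infinite)
  have nat_less: "|UNIV :: nat set| <o |X|"
  proof (rule ccontr)
    assume "\<not> |UNIV :: nat set| <o |X|"
    then have "|X| \<le>o |UNIV :: nat set|"
      using not_ordLess_iff_ordLeq[OF card_of_Well_order card_of_Well_order] by blast
    then obtain f :: "'a \<Rightarrow> nat" where "inj_on f X"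
      unfolding card_of_ordLeq[symmetric] by blast
    then show False using assms by (auto intro: countableI)
  qed
  have S_less: "|S \<xi>| <o |X|" if "\<xi> \<in> X" for \<xi>
    unfolding S_def
    using inf card_of_underS[OF card_of_Card_order, of \<xi> X] that nat_less
    by (intro card_of_Plus_ordLess_infinite) (simp_all add: Field_card_of)
  have S_inf: "infinite (S \<xi>)" for \<xi>
    by (simp add: S_def)
  \<comment> \<open>The disjoint sum of sets of the prescribed sizes has the size of
    \<open>X\<close>; a bijection lays the blocks out on \<open>X\<close> itself.\<close>
  have "|SIGMA \<xi> : X. S \<xi>| \<le>o |X|"
  proof (rule card_of_Sigma_ordLeq_infinite[OF inf])
    show "|X| \<le>o |X|"
      by (rule card_of_mono1) simp
    show "\<forall>\<xi> \<in> X. |S \<xi>| \<le>o |X|"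
      using S_less ordLess_imp_ordLeq by blast
  qed
  moreover have "|X| \<le>o |SIGMA \<xi> : X. S \<xi>|"
  proof -
    have "inj_on (\<lambda>\<xi>. (\<xi>, Inr 0 :: 'a + nat)) X" "(\<lambda>\<xi>. (\<xi>, Inr 0 :: 'a + nat)) ` X \<subseteq> (SIGMA \<xi> : X. S \<xi>)"
      by (auto simp: inj_on_def S_def)
    then show ?thesis
      using card_of_ordLeq by blast
  qed
  ultimately have "|SIGMA \<xi> : X. S \<xi>| =o |X|"
    by (simp add: ordIso_iff_ordLeq)
  then obtain f where f: "bij_betw f (SIGMA \<xi> : X. S \<xi>) X"
    using card_of_ordIso by blast
  define c where "c x = fst (inv_into (SIGMA \<xi> : X. S \<xi>) f x)" for x
  define V where "V \<xi> = f ` ({\<xi>} \<times> S \<xi>)" for \<xi>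
  have cf: "c (f (\<xi>, y)) = \<xi>" if "\<xi> \<in> X" "y \<in> S \<xi>" for \<xi> y
  proof -
    have "inv_into (SIGMA \<xi> : X. S \<xi>) f (f (\<xi>, y)) = (\<xi>, y)"
      using f that by (intro inv_into_f_f) (auto simp: bij_betw_def)
    then show ?thesis by (simp add: c_def)
  qed
  have surj: "\<exists>\<xi> y. \<xi> \<in> X \<and> y \<in> S \<xi> \<and> x = f (\<xi>, y)" if "x \<in> X" for x
  proof -
    have "x \<in> f ` (SIGMA \<xi> : X. S \<xi>)"
      using f that unfolding bij_betw_def by simp
    then show ?thesis by blast
  qed
  have fX: "f (\<xi>, y) \<in> X" if "\<xi> \<in> X" "y \<in> S \<xi>" for \<xi> y
    using f that by (auto simp: bij_betw_def)
  have Veq: "V \<xi> = {x \<in> X. c x = \<xi>}" if "\<xi> \<in> X" for \<xi>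
  proof (intro equalityI subsetI)
    fix x assume "x \<in> V \<xi>"
    then obtain y where "y \<in> S \<xi>" "x = f (\<xi>, y)" unfolding V_def by blast
    then show "x \<in> {x \<in> X. c x = \<xi>}" using fX cf that by simp
  next
    fix x assume "x \<in> {x \<in> X. c x = \<xi>}"
    then obtain \<zeta> y where "\<zeta> \<in> X" "y \<in> S \<zeta>" "x = f (\<zeta>, y)" "c x = \<xi>" using surj by blast
    then show "x \<in> V \<xi>" using cf unfolding V_def by auto
  qed
  have cX: "c x \<in> X" if "x \<in> X" for x
    using surj[OF that] cf by auto
  have VS: "|V \<xi>| =o |S \<xi>|" if "\<xi> \<in> X" for \<xi>
  proof -
    have "bij_betw (\<lambda>y. f (\<xi>, y)) (S \<xi>) (V \<xi>)"
      unfolding bij_betw_def V_def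
    proof
      show "inj_on (\<lambda>y. f (\<xi>, y)) (S \<xi>)"
        using f that unfolding bij_betw_def inj_on_def by blast
    qed auto
    then show ?thesis
      using card_of_ordIso ordIso_symmetric by blast
  qed
  have Vinf: "infinite (V \<xi>)" if "\<xi> \<in> X" for \<xi>
    using VS[OF that] S_inf card_of_ordIso_finite by blast
  have Wle: "|\<Union> (V ` underS |X| \<xi>)| \<le>o |V \<xi>|" if "\<xi> \<in> X" for \<xi>
  proof -
    have "|underS ?r \<xi>| \<le>o |S \<xi>|"
      unfolding S_def by (rule card_of_Plus1)
    then have le: "|underS ?r \<xi>| \<le>o |V \<xi>|"
      using VS[OF that] ordIso_symmetric ordLeq_ordIso_trans by blast
    have "|V \<zeta>| \<le>o |V \<xi>|" if \<zeta>: "\<zeta> \<in> underS ?r \<xi>" for \<zeta>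
    proof -
      have "\<zeta> \<in> X"
        using \<zeta> Field_card_of[of X] by (auto simp: underS_def Field_def)
      have "Well_order ?r" by (rule card_of_Well_order)
      then have "trans ?r" "antisym ?r"
        by (auto simp: order_on_defs)
      then have "underS ?r \<zeta> \<subseteq> underS ?r \<xi>"
        using \<zeta> unfolding underS_def by (auto dest: transD antisymD)
      then have "S \<zeta> \<subseteq> S \<xi>"
        unfolding S_def by auto
      then have "|S \<zeta>| \<le>o |S \<xi>|" by (rule card_of_mono1)
      then show ?thesis
        using VS[OF \<open>\<zeta> \<in> X\<close>] VS[OF \<open>\<xi> \<in> X\<close>] ordIso_symmetric
          ordIso_ordLeq_trans ordLeq_ordIso_trans by blast
    qed
    moreover have "infinite (V \<xi>)"
      using VS[OF that] S_inf card_of_ordIso_finite by blast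
    ultimately show ?thesis
      using le by (intro card_of_UNION_ordLeq_infinite) auto
  qed
  have Vless: "|V \<xi>| <o |X|" if "\<xi> \<in> X" for \<xi>
    using VS[OF that] S_less[OF that] ordIso_ordLess_trans by blast
  show ?thesis
    by (rule that[of c V]) (intro ballI cX Veq Vinf Vless Wle; assumption)+
qed

text \<open>Each block \<open>V \<xi>\<close> has a system by induction. The union
  \<open>W \<xi>\<close> of the preceding blocks is mapped into \<open>V \<xi>\<close> by an
  injection \<open>\<phi> \<xi>\<close>, and the system is pulled back along the identity and
  \<open>\<phi> \<xi>\<close> to \<open>V \<xi> \<union> W \<xi>\<close>. Stages are ordered by
  block and then within the block. A nonempty finite set covered before a stage thus comes from
  earlier blocks, which means that it is a subset of \<open>W \<xi>\<close>, or from earlier stages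
  of the same block.\<close>

lemma covering_system_exists:
  fixes X :: "'a set"
  assumes "infinite X"
  shows "\<exists>I R Y. covering_system X I R Y"
proof -
  have "wf (inv_image (ordLess :: ('a rel \<times> 'a rel) set) card_of)"
    by (intro wf_inv_image wf_ordLess)
  then show ?thesis
    using assms
  proof (induction X rule: wf_induct_rule)
    case (less X)
    show ?case
    proof (cases "countable X")
      case True
      then show ?thesis using less.prems covering_system_countable by blast
    next
      case False
      obtain c V where blocks: "\<forall>x \<in> X. c x \<in> X" "\<forall>\<xi> \<in> X. V \<xi> = {x \<in> X. c x = \<xi>}"
        "\<forall>\<xi> \<in> X. infinite (V \<xi>)" "\<forall>\<xi> \<in> X. |V \<xi>| <o |X|"
        "\<forall>\<xi> \<in> X. |\<Union> (V ` underS |X| \<xi>)| \<le>o |V \<xi>|"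
        using block_decomposition[OF False] .
      note cX = bspec[OF blocks(1)] and V = bspec[OF blocks(2)] and Vinf = bspec[OF blocks(3)]
        and Vless = bspec[OF blocks(4)] and Wle = bspec[OF blocks(5)]
      define r where "r = |X| - Id"
      have wo: "Well_order |X|" by (rule card_of_Well_order)
      then have "wf r" "trans r"
        unfolding r_def order_on_defs by (auto intro: trans_diff_Id)
      have rtot: "(\<xi>, \<zeta>) \<in> r \<or> (\<zeta>, \<xi>) \<in> r" if "\<xi> \<in> X" "\<zeta> \<in> X" "\<xi> \<noteq> \<zeta>" for \<xi> \<zeta>
        using wo that Field_card_of[of X] unfolding r_def order_on_defs total_on_def by auto
      have rX: "\<zeta> \<in> X \<and> \<xi> \<in> X" if "(\<zeta>, \<xi>) \<in> r" for \<zeta> \<xi>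
        using that Field_card_of[of X] by (auto simp: r_def Field_def)
      have irr: "(\<xi>, \<xi>) \<notin> r" for \<xi> by (simp add: r_def)
      define W where "W \<xi> = (\<Union>\<zeta> \<in> underS |X| \<xi>. V \<zeta>)" for \<xi>
      have W: "W \<xi> = {x \<in> X. (c x, \<xi>) \<in> r}" for \<xi>
      proof -
        have "underS |X| \<xi> = {\<zeta> \<in> X. (\<zeta>, \<xi>) \<in> r}"
          using rX unfolding underS_def r_def by auto
        then show ?thesis
          unfolding W_def using V cX by auto
      qed
      have "\<exists>f. inj_on f (W \<xi>) \<and> f ` W \<xi> \<subseteq> V \<xi>" if "\<xi> \<in> X" for \<xi>
        using Wle[OF that] unfolding card_of_ordLeq[symmetric] W_def .
      then obtain \<phi> where \<phi>: "\<And>\<xi>. \<xi> \<in> X \<Longrightarrow> inj_on (\<phi> \<xi>) (W \<xi>)" "\<And>\<xi>. \<xi> \<in> X \<Longrightarrow> \<phi> \<xi> ` W \<xi> \<subseteq> V \<xi>"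
        by metis
      have "\<exists>I R Y. covering_system (V \<xi>) I R Y" if "\<xi> \<in> X" for \<xi>
        using less.IH[of "V \<xi>"] Vless Vinf that by simp
      then obtain J Q T where sys: "\<And>\<xi>. \<xi> \<in> X \<Longrightarrow> covering_system (V \<xi>) (J \<xi>) (Q \<xi>) (T \<xi>)"
        by metis
      note sysD = covering_systemD[OF sys]
      have JV: "J \<xi> \<subseteq> V \<xi>" if "\<xi> \<in> X" for \<xi>
        using sysD(1)[OF that] .
      define I where "I = {a \<in> X. a \<in> J (c a)}"
      define R where "R = {(b, a). b \<in> I \<and> a \<in> I \<and> ((c b, c a) \<in> r \<or> c b = c a \<and> (b, a) \<in> Q (c a))}"
      define Y where "Y a = T (c a) a \<union> {w \<in> W (c a). \<phi> (c a) w \<in> T (c a) a}" for a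
      \<comment> \<open>The image of \<open>s\<close> under the identity on \<open>V \<xi>\<close>
        and \<open>\<phi> \<xi>\<close> on \<open>W \<xi>\<close>. Points may be identified, which
        is harmless as only inclusions in sets pulled back along this map are tested.\<close>
      define pull where "pull \<xi> s = (s \<inter> V \<xi>) \<union> \<phi> \<xi> ` (s \<inter> W \<xi>)" for \<xi> s
      have IX: "a \<in> X \<and> c a \<in> X \<and> a \<in> J (c a)" if "a \<in> I" for a
        using that cX by (simp add: I_def)
      have inI: "a \<in> I \<and> c a = \<xi>" if "\<xi> \<in> X" "a \<in> J \<xi>" for a \<xi>
        using JV[OF that(1)] V[OF that(1)] that(2) by (auto simp: I_def)
      have TV: "T \<xi> a \<subseteq> V \<xi>" "countable (T \<xi> a)" if "\<xi> \<in> X" "a \<in> J \<xi>" for \<xi> a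
        using sysD(5,6)[OF that] by blast+
      have VW: "V \<xi> \<inter> W \<xi> = {}" if "\<xi> \<in> X" for \<xi>
        using V[OF that] W irr by auto
      have subY: "s \<subseteq> Y a \<longleftrightarrow> s \<subseteq> V \<xi> \<union> W \<xi> \<and> pull \<xi> s \<subseteq> T \<xi> a" if "\<xi> \<in> X" "a \<in> J \<xi>" for s \<xi> a
        using inI[OF that] TV(1)[OF that] VW[OF that(1)] unfolding Y_def pull_def by blast
      have pull_finite: "finite (pull \<xi> s)" if "finite s" for \<xi> s
        using that by (simp add: pull_def)
      have pull_V: "pull \<xi> s \<subseteq> V \<xi>" if "\<xi> \<in> X" for \<xi> s
        using \<phi>(2)[OF that] by (auto simp: pull_def)
      have YWV: "Y a \<subseteq> V (c a) \<union> W (c a)" if "a \<in> I" for a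
        using subY[of "c a" a "Y a"] IX[OF that] by simp
      have YW: "Y b \<subseteq> W \<xi>" if "b \<in> I" "(c b, \<xi>) \<in> r" for b \<xi>
      proof
        fix x assume "x \<in> Y b"
        then have "x \<in> V (c b) \<or> x \<in> W (c b)" using YWV[OF that(1)] by blast
        then have "x \<in> X" "c x = c b \<or> (c x, c b) \<in> r"
          using V[of "c b"] IX[OF that(1)] W by auto
        then have "(c x, \<xi>) \<in> r" using that(2) transD[OF \<open>trans r\<close>] by metis
        with \<open>x \<in> X\<close> show "x \<in> W \<xi>" using W by simp
      qed
      have cover: "\<exists>a \<in> I. c a \<in> c ` s \<and> s \<subseteq> Y a" if s: "finite s" "s \<noteq> {}" "s \<subseteq> X" for s
      proof -
        have "finite (c ` s)" "c ` s \<noteq> {}" using s by auto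
        \<comment> \<open>The last block that \<open>s\<close> meets: the rest of \<open>s\<close>
          lies in \<open>W \<zeta>\<close>.\<close>
        then obtain \<zeta> where \<zeta>: "\<zeta> \<in> c ` s" "\<And>\<xi>. (\<zeta>, \<xi>) \<in> r \<Longrightarrow> \<xi> \<notin> c ` s"
          using finite_max_wf[OF \<open>wf r\<close>, of "c ` s"] by blast
        have \<zeta>X: "\<zeta> \<in> X" using \<zeta>(1) s(3) cX by blast
        have "s \<subseteq> V \<zeta> \<union> W \<zeta>"
        proof
          fix x assume x: "x \<in> s"
          then have "c x = \<zeta> \<or> (c x, \<zeta>) \<in> r"
            using \<zeta>(2) rtot[of "c x" \<zeta>] \<zeta>X s(3) cX by blast
          then show "x \<in> V \<zeta> \<union> W \<zeta>" using V[OF \<zeta>X] W x s(3) by auto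
        qed
        moreover obtain a where a: "a \<in> J \<zeta>" "pull \<zeta> s \<subseteq> T \<zeta> a"
          using sysD(8)[OF \<zeta>X pull_finite[OF s(1)] pull_V[OF \<zeta>X]] by blast
        ultimately have "s \<subseteq> Y a" using subY[OF \<zeta>X a(1), of s] by simp
        then show ?thesis using inI[OF \<zeta>X a(1)] \<zeta>(1) by blast
      qed
      have "covering_system X I R Y"
        unfolding covering_system_def
      proof (intro conjI ballI allI impI)
        show "I \<subseteq> X" by (auto simp: I_def)
        show "wf R"
        proof (rule wfI_min)
          fix q :: 'a and A assume "q \<in> A"
          then obtain \<xi> where \<xi>: "\<xi> \<in> c ` A" "\<And>\<zeta>. (\<zeta>, \<xi>) \<in> r \<Longrightarrow> \<zeta> \<notin> c ` A"
            using wfE_min'[OF \<open>wf r\<close>, of "c ` A"] by blast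
          show "\<exists>z \<in> A. \<forall>y. (y, z) \<in> R \<longrightarrow> y \<notin> A"
          proof (cases "\<xi> \<in> X")
            case True
            then have "wf (Q \<xi>)" using sysD(2) by blast
            moreover have "{a \<in> A. c a = \<xi>} \<noteq> {}" using \<xi>(1) by blast
            ultimately obtain z where "z \<in> {a \<in> A. c a = \<xi>}"
              "\<And>y. (y, z) \<in> Q \<xi> \<Longrightarrow> y \<notin> {a \<in> A. c a = \<xi>}"
              by (rule wfE_min') blast
            then show ?thesis using \<xi>(2) unfolding R_def by blast
          next
            case False
            obtain z where "z \<in> A" "c z = \<xi>" using \<xi>(1) by blast
            then show ?thesis using False IX unfolding R_def by blast
          qed
        qed
        show "trans R"
        proof (rule transI)
          fix x y z assume xy: "(x, y) \<in> R" and yz: "(y, z) \<in> R"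
          have "c z \<in> X" using yz IX unfolding R_def by blast
          then have "trans (Q (c z))" using sysD(3) by blast
          then show "(x, z) \<in> R"
            using xy yz transD[OF \<open>trans r\<close>] unfolding R_def by (auto dest: transD)
        qed
        show "total_on I R"
        proof (rule total_onI)
          fix x y assume xy: "x \<in> I" "y \<in> I" "x \<noteq> y"
          show "(x, y) \<in> R \<or> (y, x) \<in> R"
          proof (cases "c x = c y")
            case True
            have "total_on (J (c x)) (Q (c x))" using sysD(4) IX[OF xy(1)] by blast
            then show ?thesis
              using True xy IX[OF xy(1)] IX[OF xy(2)] unfolding R_def total_on_def by auto
          next
            case False
            then show ?thesis using rtot[of "c x" "c y"] IX xy unfolding R_def by auto
          qed
        qed
        show "\<exists>a \<in> I. s \<subseteq> Y a" if s: "finite s" "s \<subseteq> X" for s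
        proof (cases "s = {}")
          case True
          obtain x where "x \<in> X" using less.prems by fastforce
          then show ?thesis using cover[of "{x}"] True by auto
        next
          case False
          then show ?thesis using cover s by blast
        qed
        fix a assume a: "a \<in> I"
        let ?\<xi> = "c a"
        have \<xi>: "?\<xi> \<in> X" "a \<in> J ?\<xi>" using IX[OF a] by auto
        have "countable {w \<in> W ?\<xi>. \<phi> ?\<xi> w \<in> T ?\<xi> a}"
        proof (rule countable_image_inj_on)
          show "countable (\<phi> ?\<xi> ` {w \<in> W ?\<xi>. \<phi> ?\<xi> w \<in> T ?\<xi> a})"
            by (rule countable_subset[OF _ TV(2)[OF \<xi>]]) auto
          show "inj_on (\<phi> ?\<xi>) {w \<in> W ?\<xi>. \<phi> ?\<xi> w \<in> T ?\<xi> a}"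
            by (rule inj_on_subset[OF \<phi>(1)[OF \<xi>(1)]]) auto
        qed
        then show "countable (Y a)" using TV(2)[OF \<xi>] by (simp add: Y_def)
        show "Y a \<subseteq> X" using YWV[OF a] V[OF \<xi>(1)] W by auto
        show "infinite (Y a - (\<Union>b \<in> {b \<in> I. (b, a) \<in> R}. Y b))"
        proof (rule infinite_super)
          show "infinite (T ?\<xi> a - (\<Union>b \<in> {b \<in> J ?\<xi>. (b, a) \<in> Q ?\<xi>}. T ?\<xi> b))"
            by (rule sysD(7)[OF \<xi>])
          \<comment> \<open>Points of the block are never in \<open>W\<close>, so what is new in the
            system of the block is new against all earlier blocks too.\<close>
          show "T ?\<xi> a - (\<Union>b \<in> {b \<in> J ?\<xi>. (b, a) \<in> Q ?\<xi>}. T ?\<xi> b)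
            \<subseteq> Y a - (\<Union>b \<in> {b \<in> I. (b, a) \<in> R}. Y b)"
          proof
            fix x assume x: "x \<in> T ?\<xi> a - (\<Union>b \<in> {b \<in> J ?\<xi>. (b, a) \<in> Q ?\<xi>}. T ?\<xi> b)"
            then have xV: "x \<in> V ?\<xi>" using TV(1)[OF \<xi>] by blast
            have "x \<notin> Y b" if b: "b \<in> I" "(b, a) \<in> R" for b
            proof (cases "(c b, ?\<xi>) \<in> r")
              case True
              then show ?thesis using YW[OF b(1) True] VW[OF \<xi>(1)] xV by blast
            next
              case False
              then have "c b = ?\<xi>" "(b, a) \<in> Q ?\<xi>" using b(2) by (auto simp: R_def)
              then show ?thesis
                using x IX[OF b(1)] xV VW[OF \<xi>(1)] unfolding Y_def by auto
            qed
            then show "x \<in> Y a - (\<Union>b \<in> {b \<in> I. (b, a) \<in> R}. Y b)"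
              using x by (auto simp: Y_def)
          qed
        qed
        obtain m Z where m: "aleph_le m (V ?\<xi>)"
          and Z: "\<And>s. finite s \<Longrightarrow> s \<noteq> {} \<Longrightarrow>
            (\<exists>b \<in> J ?\<xi>. (b, a) \<in> Q ?\<xi> \<and> s \<subseteq> T ?\<xi> b) \<longleftrightarrow> (\<exists>i<m. s \<subseteq> Z i)"
          using sysD(9)[OF \<xi>] by metis
        \<comment> \<open>The sets of the block are pulled back, and the additional index
          \<open>m\<close> is given to \<open>W\<close>, which accounts for all earlier blocks at
          once.\<close>
        define Z' where "Z' i = (if i < m then (Z i \<inter> V ?\<xi>) \<union> {w \<in> W ?\<xi>. \<phi> ?\<xi> w \<in> Z i} else W ?\<xi>)" for i
        \<comment> \<open>The empty set has to be excluded: at the first stage of the first block it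
          is a subset of \<open>W ?\<xi>\<close>, but no earlier stage exists.\<close>
        have "(\<exists>b \<in> I. (b, a) \<in> R \<and> s \<subseteq> Y b) \<longleftrightarrow> (\<exists>i<Suc m. s \<subseteq> Z' i)"
          if s: "finite s" "s \<noteq> {}" for s
        proof -
          have pull_ne: "pull ?\<xi> s \<noteq> {}" if "s \<subseteq> V ?\<xi> \<union> W ?\<xi>"
            using that s(2) unfolding pull_def by blast
          have Z'm: "s \<subseteq> Z' i \<longleftrightarrow> s \<subseteq> V ?\<xi> \<union> W ?\<xi> \<and> pull ?\<xi> s \<subseteq> Z i" if "i < m" for i
          proof -
            have "Z' i = (Z i \<inter> V ?\<xi>) \<union> {w \<in> W ?\<xi>. \<phi> ?\<xi> w \<in> Z i}"
              using that by (simp add: Z'_def)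
            then show ?thesis
              using VW[OF \<xi>(1)] unfolding pull_def by blast
          qed
          have 1: "(\<exists>b \<in> I. (c b, ?\<xi>) \<in> r \<and> s \<subseteq> Y b) \<longleftrightarrow> s \<subseteq> W ?\<xi>"
          proof
            assume sW: "s \<subseteq> W ?\<xi>"
            then obtain b where b: "b \<in> I" "c b \<in> c ` s" "s \<subseteq> Y b"
              using cover[OF s] W by blast
            moreover have "(c b, ?\<xi>) \<in> r" using b(2) sW W by auto
            ultimately show "\<exists>b \<in> I. (c b, ?\<xi>) \<in> r \<and> s \<subseteq> Y b" by blast
          qed (use YW in blast)
          have 2: "(\<exists>b \<in> I. c b = ?\<xi> \<and> (b, a) \<in> Q ?\<xi> \<and> s \<subseteq> Y b) \<longleftrightarrow> (\<exists>i<m. s \<subseteq> Z' i)"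
          proof -
            have "(\<exists>b \<in> I. c b = ?\<xi> \<and> (b, a) \<in> Q ?\<xi> \<and> s \<subseteq> Y b) \<longleftrightarrow>
              (\<exists>b \<in> J ?\<xi>. (b, a) \<in> Q ?\<xi> \<and> s \<subseteq> Y b)"
              using IX inI[OF \<xi>(1)] by metis
            also have "\<dots> \<longleftrightarrow> s \<subseteq> V ?\<xi> \<union> W ?\<xi> \<and> (\<exists>b \<in> J ?\<xi>. (b, a) \<in> Q ?\<xi> \<and> pull ?\<xi> s \<subseteq> T ?\<xi> b)"
              using subY[OF \<xi>(1)] by auto
            also have "\<dots> \<longleftrightarrow> s \<subseteq> V ?\<xi> \<union> W ?\<xi> \<and> (\<exists>i<m. pull ?\<xi> s \<subseteq> Z i)"
              using Z[OF pull_finite[OF s(1)] pull_ne] by (intro conj_cong) auto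
            also have "\<dots> \<longleftrightarrow> (\<exists>i<m. s \<subseteq> Z' i)"
              using Z'm by meson
            finally show ?thesis .
          qed
          have "(\<exists>i<Suc m. s \<subseteq> Z' i) \<longleftrightarrow> s \<subseteq> W ?\<xi> \<or> (\<exists>i<m. s \<subseteq> Z' i)"
          proof -
            have "Z' m = W ?\<xi>" by (simp add: Z'_def)
            then show ?thesis unfolding less_Suc_eq by blast
          qed
          moreover have "(\<exists>b \<in> I. (b, a) \<in> R \<and> s \<subseteq> Y b) \<longleftrightarrow>
            (\<exists>b \<in> I. (c b, ?\<xi>) \<in> r \<and> s \<subseteq> Y b) \<or> (\<exists>b \<in> I. c b = ?\<xi> \<and> (b, a) \<in> Q ?\<xi> \<and> s \<subseteq> Y b)"
            using a unfolding R_def by auto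
          ultimately show ?thesis using 1 2 by blast
        qed
        \<comment> \<open>The block is strictly smaller than \<open>X\<close>, which pays for the
          additional set.\<close>
        moreover have "aleph_le (Suc m) X"
          using m Vless[OF \<xi>(1)] by (rule aleph_le_Suc)
        ultimately show "\<exists>m Z. aleph_le m X \<and> (\<forall>s. finite s \<longrightarrow> s \<noteq> {} \<longrightarrow>
          ((\<exists>b \<in> I. (b, a) \<in> R \<and> s \<subseteq> Y b) \<longleftrightarrow> (\<exists>i<m. s \<subseteq> Z i)))"
          by blast
      qed
      then show ?thesis by blast
    qed
  qed
qed

text \<open>The new points of distinct stages are distinct, so \<open>X\<close> has room for
  countably many points per stage; conversely, the countable sets \<open>Y a\<close> cover
  \<open>X\<close>.\<close>

lemma covering_system_bij:
  fixes X :: "'a set"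
  assumes "infinite X" "covering_system X I R Y"
  shows "\<exists>f. bij_betw f X (I \<times> (UNIV :: nat set))"
proof -
  note sys = covering_systemD[OF assms(2)]
  define N where "N a = Y a - (\<Union>b \<in> {b \<in> I. (b, a) \<in> R}. Y b)" for a
  have N: "infinite (N a)" "N a \<subseteq> X" if "a \<in> I" for a
    using sys(6,7)[OF that] unfolding N_def by blast+
  have "\<exists>f :: nat \<Rightarrow> 'a. inj f \<and> range f \<subseteq> N a" if "a \<in> I" for a
    using N(1)[OF that] unfolding infinite_iff_countable_subset by blast
  then obtain f :: "'a \<Rightarrow> nat \<Rightarrow> 'a" where f: "\<And>a. a \<in> I \<Longrightarrow> inj (f a)" "\<And>a. a \<in> I \<Longrightarrow> range (f a) \<subseteq> N a"
    by metis
  have disj: "a = b" if "a \<in> I" "b \<in> I" "x \<in> N a" "x \<in> N b" for a b x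
    using sys(4) that unfolding N_def total_on_def by blast
  have "inj_on (\<lambda>(a, k). f a k) (I \<times> UNIV)"
  proof (rule inj_onI, clarify)
    fix a k b l assume *: "a \<in> I" "b \<in> I" "f a k = f b l"
    then have "a = b" using f(2)[of a] f(2)[of b] disj[of a b "f a k"] by (metis rangeI subsetD)
    then show "a = b \<and> k = l" using * f(1)[of a] by (auto dest: injD)
  qed
  moreover have "(\<lambda>(a, k). f a k) ` (I \<times> UNIV) \<subseteq> X"
    using f(2) N(2) by fastforce
  ultimately have "|I \<times> (UNIV :: nat set)| \<le>o |X|"
    unfolding card_of_ordLeq[symmetric] by blast
  moreover have "|X| \<le>o |I \<times> (UNIV :: nat set)|"
  proof -
    have "X \<subseteq> (\<lambda>(a, k). from_nat_into (Y a) k) ` (I \<times> UNIV)"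
    proof
      fix x assume "x \<in> X"
      then obtain a where "a \<in> I" "{x} \<subseteq> Y a" using sys(8)[of "{x}"] by auto
      moreover from this obtain k where "from_nat_into (Y a) k = x"
        using sys(5) from_nat_into_surj[of "Y a" x] by auto
      ultimately show "x \<in> (\<lambda>(a, k). from_nat_into (Y a) k) ` (I \<times> UNIV)" by force
    qed
    then show ?thesis
      using card_of_mono1 card_of_image ordLeq_transitive by blast
  qed
  ultimately have "|X| =o |I \<times> (UNIV :: nat set)|"
    by (simp add: ordIso_iff_ordLeq)
  then show ?thesis using card_of_ordIso by blast
qed

end

section \<open>Disjoint amalgamation in strong classes\<close>

lemma univ_restrict_struct [simp]: "univ (restrict_struct A S) = univ A \<inter> S"
  by (simp add: restrict_struct_def)

lemma interp_restrict_struct [simp]: "xs \<in> interp (restrict_struct A S) R \<longleftrightarrow> xs \<in> interp A R \<and> set xs \<subseteq> S"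
  by (auto simp: restrict_struct_def)

text \<open>The empty tuple is always compared, so nullary symbols count even when the underlying
  sets are disjoint.\<close>

definition agree :: "('r, 'a) rstruct \<Rightarrow> ('r, 'a) rstruct \<Rightarrow> bool" where
  "agree A B \<longleftrightarrow> (\<forall>R xs. set xs \<subseteq> univ A \<longrightarrow> set xs \<subseteq> univ B \<longrightarrow> (xs \<in> interp A R \<longleftrightarrow> xs \<in> interp B R))"

lemma agreeD: "agree A B \<Longrightarrow> set xs \<subseteq> univ A \<Longrightarrow> set xs \<subseteq> univ B \<Longrightarrow> xs \<in> interp A R \<longleftrightarrow> xs \<in> interp B R"
  by (simp add: agree_def)

lemma substructureD:
  assumes "substructure A B"
  shows "univ A \<subseteq> univ B" "set xs \<subseteq> univ A \<Longrightarrow> xs \<in> interp A R \<longleftrightarrow> xs \<in> interp B R"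
proof -
  show "univ A \<subseteq> univ B"
    using assms by (simp add: substructure_def)
  have "A = restrict_struct B (univ A)"
    using assms unfolding substructure_def by blast
  then have "xs \<in> interp A R \<longleftrightarrow> xs \<in> interp (restrict_struct B (univ A)) R"
    by simp
  then show "xs \<in> interp A R \<longleftrightarrow> xs \<in> interp B R" if "set xs \<subseteq> univ A"
    using that by simp
qed

lemma substructure_agree:
  assumes "substructure A C" "substructure B C"
  shows "agree A B"
  unfolding agree_def
proof (intro allI impI)
  fix R xs assume "set xs \<subseteq> univ A" "set xs \<subseteq> univ B"
  then show "xs \<in> interp A R \<longleftrightarrow> xs \<in> interp B R"
    using substructureD(2)[OF assms(1), of xs R] substructureD(2)[OF assms(2), of xs R] by blast
qed

lemma substructureI:
  assumes "is_struct ar A" "univ A \<subseteq> univ B"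
    and "\<And>R xs. set xs \<subseteq> univ A \<Longrightarrow> xs \<in> interp A R \<longleftrightarrow> xs \<in> interp B R"
  shows "substructure A B"
proof -
  have "xs \<in> interp A R \<longleftrightarrow> xs \<in> interp B R \<and> set xs \<subseteq> univ A" for R xs
    using assms(1) assms(3)[of xs R] unfolding is_struct_def by blast
  then have "interp A R = interp B R \<inter> lists (univ A)" for R
    unfolding lists_eq_set by blast
  then show ?thesis
    using assms(2) unfolding substructure_def restrict_struct_def
    by (intro conjI rstruct.expand) auto
qed

lemma substructure_restrict_struct_mono:
  assumes "substructure A B"
  shows "substructure (restrict_struct A S) (restrict_struct B S)"
proof -
  have "A = restrict_struct B (univ A)"
    using assms unfolding substructure_def by blast
  then have *: "interp A R = interp B R \<inter> lists (univ A)" for R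
    by (metis restrict_struct_def rstruct.sel(2))
  have "univ A \<subseteq> univ B" using assms by (rule substructureD)
  then show ?thesis
    unfolding substructure_def restrict_struct_def by (auto simp: *)
qed

lemma is_struct_restrict: "is_struct ar A \<Longrightarrow> is_struct ar (restrict_struct A S)"
  unfolding is_struct_def by (metis Int_subset_iff interp_restrict_struct univ_restrict_struct)

lemma restrict_struct_substructure: "is_struct ar A \<Longrightarrow> substructure (restrict_struct A S) A"
  by (rule substructureI[OF is_struct_restrict]) auto

lemma restrict_struct_eqI:
  assumes "agree A B"
  shows "restrict_struct A (univ A \<inter> univ B) = restrict_struct B (univ A \<inter> univ B)"
proof (intro rstruct.expand conjI ext)
  show "interp (restrict_struct A (univ A \<inter> univ B)) R = interp (restrict_struct B (univ A \<inter> univ B)) R" for R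
    using agreeD[OF assms(1), of _ R] by (intro set_eqI) auto
qed auto

text \<open>Amalgams are given on arbitrary points of the type; this moves them to a prescribed
  underlying set.\<close>

definition pullback :: "('a \<Rightarrow> 'b) \<Rightarrow> 'a set \<Rightarrow> ('r, 'b) rstruct \<Rightarrow> ('r, 'a) rstruct" where
  "pullback g D C = RStruct D (\<lambda>R. {xs. set xs \<subseteq> D \<and> map g xs \<in> interp C R})"

lemma univ_pullback [simp]: "univ (pullback g D C) = D"
  by (simp add: pullback_def)

lemma interp_pullback [simp]: "xs \<in> interp (pullback g D C) R \<longleftrightarrow> set xs \<subseteq> D \<and> map g xs \<in> interp C R"
  by (simp add: pullback_def)

locale strong_class =
  fixes ar :: "'r \<Rightarrow> nat" and K :: "('r, 'a) rstruct set"
  assumes strong: "strong_fraisse_class ar K"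
    and nontrivial: "nontrivial_class K"
begin

lemma fraisse: "fraisse_class ar K"
  using strong by (simp add: strong_fraisse_class_def)

lemma K_struct: "A \<in> K \<Longrightarrow> is_struct ar A"
  using fraisse unfolding fraisse_class_def by blast

lemma K_finite: "A \<in> K \<Longrightarrow> finite (univ A)"
  using fraisse unfolding fraisse_class_def by blast

lemma K_restrict: "A \<in> K \<Longrightarrow> restrict_struct A S \<in> K"
  using fraisse restrict_struct_substructure[OF K_struct] unfolding fraisse_class_def by blast

lemma K_set: "A \<in> K \<Longrightarrow> xs \<in> interp A R \<Longrightarrow> set xs \<subseteq> univ A"
  using K_struct unfolding is_struct_def by blast

lemmas K_substructureI = substructureI[OF K_struct]

text \<open>Embeddings preserve the empty tuple, so joint embedding makes a nullary symbol take one
  value throughout the class. This is what lets structures with disjoint underlying sets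
  agree.\<close>

lemma nil_iff:
  assumes "A \<in> K" "B \<in> K"
  shows "[] \<in> interp A R \<longleftrightarrow> [] \<in> interp B R"
proof -
  have "joint_embedding K"
    using fraisse unfolding fraisse_class_def by blast
  then have "\<exists>(C :: ('r, 'a) rstruct) f g. embedding f A C \<and> embedding g B C"
    using assms unfolding joint_embedding_def by blast
  then obtain C :: "('r, 'a) rstruct" and f g where fg: "embedding f A C" "embedding g B C"
    by blast
  have "[] \<in> interp A R \<longleftrightarrow> map f [] \<in> interp C R" "[] \<in> interp B R \<longleftrightarrow> map g [] \<in> interp C R"
    using fg unfolding embedding_def by blast+
  then show ?thesis by simp
qed

lemma K_pullback:
  assumes C: "C \<in> K" and g: "inj_on g D" "g ` D \<subseteq> univ C"
  shows "pullback g D C \<in> K"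
proof -
  let ?A = "restrict_struct C (g ` D)" and ?f = "inv_into D g"
  have uA: "univ ?A = g ` D" using g(2) by auto
  have gf: "map g (map ?f xs) = xs" if "set xs \<subseteq> g ` D" for xs
    using that by (auto simp: map_idI f_inv_into_f subset_iff)
  have "embedding ?f ?A (pullback g D C)"
    unfolding embedding_def uA
  proof (intro conjI allI ballI)
    show "inj_on ?f (g ` D)" by (rule inj_on_inv_into) simp
    show "?f ` g ` D \<subseteq> univ (pullback g D C)" by (auto simp: inv_into_into)
    fix R xs assume "xs \<in> lists (g ` D)"
    then have xs: "set xs \<subseteq> g ` D" by auto
    then have "set (map ?f xs) \<subseteq> D" by (auto intro: inv_into_into)
    then show "xs \<in> interp ?A R \<longleftrightarrow> map ?f xs \<in> interp (pullback g D C) R"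
      unfolding interp_restrict_struct interp_pullback gf[OF xs] using xs by blast
  qed
  moreover have "?f ` univ ?A = univ (pullback g D C)"
    unfolding uA using g(1) by (simp add: inv_into_image_cancel)
  ultimately have "isomorphic ?A (pullback g D C)"
    unfolding isomorphic_def by blast
  moreover have "is_struct ar (pullback g D C)"
    using K_struct[OF C] unfolding is_struct_def by fastforce
  ultimately show ?thesis
    using fraisse K_restrict[OF C] unfolding fraisse_class_def by blast
qed

text \<open>Strong amalgamation over the common part makes the union of the two embeddings
  injective, so the amalgam can be pulled back to \<open>univ A \<union> univ B\<close> and both
  embeddings become inclusions.\<close>

lemma disjoint_amalgam:
  assumes A: "A \<in> K" and B: "B \<in> K" and AB: "agree A B"
  shows "\<exists>C \<in> K. univ C = univ A \<union> univ B \<and> substructure A C \<and> substructure B C"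
proof -
  let ?E = "restrict_struct A (univ B)"
  have e0: "embedding id ?E A"
    by (auto simp: embedding_def)
  have e1: "embedding id ?E B"
    using AB by (auto simp: embedding_def agree_def)
  have "strong_amalgamation K"
    using strong by (simp add: strong_fraisse_class_def)
  note this[unfolded strong_amalgamation_def, rule_format, OF K_restrict[OF A] A B conjI[OF e0 e1]]
  then obtain C g0 g1 where C: "C \<in> K" and g0: "embedding g0 A C" and g1: "embedding g1 B C"
    and eq: "\<forall>x \<in> univ ?E. g0 (id x) = g1 (id x)"
    and im: "g0 ` univ A \<inter> g1 ` univ B = (\<lambda>x. g0 (id x)) ` univ ?E"
    by (elim bexE exE conjE)
  define g where "g x = (if x \<in> univ A then g0 x else g1 x)" for x
  have gA: "g x = g0 x" if "x \<in> univ A" for x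
    using that by (simp add: g_def)
  have gB: "g x = g1 x" if "x \<in> univ B" for x
    using that eq by (simp add: g_def)
  have inj: "inj_on g0 (univ A)" "inj_on g1 (univ B)"
    using g0 g1 by (simp_all add: embedding_def)
  \<comment> \<open>Strongness enters here: a common value is the image of a common point.\<close>
  have cross: "x = y" if x: "x \<in> univ A" and y: "y \<in> univ B" and xy: "g0 x = g1 y" for x y
  proof -
    have "g1 y \<in> g0 ` univ A"
      using x unfolding xy[symmetric] by (rule imageI)
    moreover have "g1 y \<in> g1 ` univ B"
      using y by (rule imageI)
    ultimately have "g1 y \<in> (\<lambda>x. g0 (id x)) ` univ ?E" unfolding im[symmetric] by blast
    then obtain z where z: "z \<in> univ A" "z \<in> univ B" "g1 y = g0 z" by auto
    then have "x = z" using inj(1) x xy by (auto dest: inj_onD)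
    moreover have "g1 z = g1 y" using z gA[of z] gB[of z] by simp
    then have "z = y" using inj(2) y z(2) by (auto dest: inj_onD)
    ultimately show ?thesis by simp
  qed
  let ?D = "univ A \<union> univ B"
  have "inj_on g ?D"
  proof (rule inj_onI)
    fix x y assume "x \<in> ?D" "y \<in> ?D" and gxy: "g x = g y"
    then consider "x \<in> univ A" "y \<in> univ A" | "x \<in> univ B" "y \<in> univ B"
      | "x \<in> univ A" "y \<in> univ B" | "x \<in> univ B" "y \<in> univ A" by blast
    then show "x = y"
    proof cases
      case 1 then show ?thesis using gxy inj(1) by (simp add: gA inj_on_def)
    next
      case 2 then show ?thesis using gxy inj(2) by (simp add: gB inj_on_def)
    next
      case 3 then show ?thesis using gxy cross[of x y] by (simp add: gA gB)
    next
      case 4 then show ?thesis using gxy cross[of y x] by (simp add: gA gB)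
    qed
  qed
  moreover have "g ` ?D \<subseteq> univ C"
  proof -
    have "g ` univ A = g0 ` univ A" "g ` univ B = g1 ` univ B"
      by (auto simp: gA gB intro!: image_cong)
    then show ?thesis using g0 g1 by (auto simp: embedding_def image_Un)
  qed
  ultimately have "pullback g ?D C \<in> K"
    by (rule K_pullback[OF C])
  moreover have "substructure A (pullback g ?D C)"
  proof (rule K_substructureI[OF A])
    fix R xs assume xs: "set xs \<subseteq> univ A"
    then have eq: "map g xs = map g0 xs" by (auto simp: gA subset_iff)
    have "xs \<in> lists (univ A)" using xs by auto
    then have "xs \<in> interp A R \<longleftrightarrow> map g0 xs \<in> interp C R"
      using g0 unfolding embedding_def by blast
    then show "xs \<in> interp A R \<longleftrightarrow> xs \<in> interp (pullback g ?D C) R"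
      unfolding interp_pullback eq using xs by blast
  qed auto
  moreover have "substructure B (pullback g ?D C)"
  proof (rule K_substructureI[OF B])
    fix R xs assume xs: "set xs \<subseteq> univ B"
    then have eq: "map g xs = map g1 xs" by (auto simp: gB subset_iff)
    have "xs \<in> lists (univ B)" using xs by auto
    then have "xs \<in> interp B R \<longleftrightarrow> map g1 xs \<in> interp C R"
      using g1 unfolding embedding_def by blast
    then show "xs \<in> interp B R \<longleftrightarrow> xs \<in> interp (pullback g ?D C) R"
      unfolding interp_pullback eq using xs by blast
  qed auto
  ultimately show ?thesis by (intro bexI[of _ "pullback g ?D C"]) auto
qed

text \<open>Two witnesses of non-triviality are copied to a set of the right size inside
  \<open>N\<close>. On new points, such a pair provides incompatible extensions with the same
  past.\<close>

lemma disagreeing_pair: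
  assumes "infinite N"
  shows "\<exists>F0 \<in> K. \<exists>F1 \<in> K. univ F0 = univ F1 \<and> univ F0 \<subseteq> N \<and> \<not> agree F0 F1"
proof -
  obtain E0 E1 where E: "E0 \<in> K" "E1 \<in> K" "univ E0 = univ E1" "E0 \<noteq> E1"
    using nontrivial unfolding nontrivial_class_def by blast
  obtain R xs where xs: "xs \<in> interp E0 R \<longleftrightarrow> xs \<notin> interp E1 R"
    using E(3,4) by (metis rstruct.expand set_eqI ext)
  have xsE: "set xs \<subseteq> univ E0"
    using xs K_set E by metis
  obtain S where S: "S \<subseteq> N" "finite S" "card S = card (univ E0)"
    using infinite_arbitrarily_large[OF assms] by metis
  then obtain g where g: "bij_betw g S (univ E0)"
    using K_finite[OF E(1)] finite_same_card_bij by metis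
  have gS: "inj_on g S" "g ` S \<subseteq> univ E0" "g ` S \<subseteq> univ E1"
    using g E(3) by (auto simp: bij_betw_def)
  define ys where "ys = map (inv_into S g) xs"
  have "set xs \<subseteq> g ` S" using xsE g by (simp add: bij_betw_def)
  then have "map g ys = xs" "set ys \<subseteq> S"
    by (auto simp: ys_def map_idI f_inv_into_f subset_iff inv_into_into)
  then have "\<not> agree (pullback g S E0) (pullback g S E1)"
    unfolding agree_def using xs by auto
  then show ?thesis
    using K_pullback[OF E(1) gS(1,2)] K_pullback[OF E(2) gS(1,3)] S(1)
    by (intro bexI[of _ "pullback g S E0"] bexI[of _ "pullback g S E1"]) auto
qed

text \<open>As the language is finite, a structure is coded by a finite set and finitely many finite
  sets of tuples.\<close>

lemma countable_K:
  assumes "finite (UNIV :: 'r set)" "countable Y"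
  shows "countable {A \<in> K. univ A \<subseteq> Y}"
proof (rule countable_image_inj_on)
  let ?L = "{L :: 'a list set. finite L \<and> L \<subseteq> lists Y}"
  let ?h = "\<lambda>A :: ('r, 'a) rstruct. (univ A, interp A)"
  have "countable {S. finite S \<and> S \<subseteq> Y}"
    using countable_Collect_finite_subset[OF assms(2)] by (simp add: conj_commute)
  moreover have "countable ?L"
    using countable_Collect_finite_subset[OF countable_lists[OF assms(2)]] by (simp add: conj_commute)
  then have "countable (PiE (UNIV :: 'r set) (\<lambda>_. ?L))"
    using assms(1) by (intro countable_PiE) auto
  ultimately have "countable ({S. finite S \<and> S \<subseteq> Y} \<times> PiE (UNIV :: 'r set) (\<lambda>_. ?L))"
    by (rule countable_SIGMA)
  moreover have "?h ` {A \<in> K. univ A \<subseteq> Y} \<subseteq> {S. finite S \<and> S \<subseteq> Y} \<times> PiE (UNIV :: 'r set) (\<lambda>_. ?L)"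
  proof -
    have "finite (interp A R) \<and> interp A R \<subseteq> lists Y" if "A \<in> K" "univ A \<subseteq> Y" for A R
    proof -
      have "interp A R \<subseteq> {xs. set xs \<subseteq> univ A \<and> length xs = ar R}"
        using K_struct[OF that(1)] by (auto simp: is_struct_def)
      then show ?thesis
        using finite_lists_length_eq[OF K_finite[OF that(1)], of "ar R"] that(2)
        by (auto intro: finite_subset)
    qed
    then show ?thesis using K_finite by auto
  qed
  ultimately show "countable (?h ` {A \<in> K. univ A \<subseteq> Y})"
    by (rule countable_subset[rotated])
  show "inj_on ?h {A \<in> K. univ A \<subseteq> Y}"
    by (auto intro!: inj_onI rstruct.expand)
qed

end

section \<open>The generic bits of a structure\<close>

locale covered_class = strong_class ar K
  for ar :: "'r::finite \<Rightarrow> nat" and K :: "('r, 'a) rstruct set" +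
  fixes X I :: "'a set" and R :: "'a rel" and Y :: "'a \<Rightarrow> 'a set"
  assumes system: "covering_system X I R Y"
    and dap: "n \<ge> 1 \<Longrightarrow> aleph_le n X \<Longrightarrow> disjoint_amalgamation (n + 1) K"
begin

section \<open>Stages and amalgamation over the past\<close>

definition conds :: "('r, 'a) rstruct set" where
  "conds = {A \<in> K. univ A \<subseteq> X}"

definition stage :: "'a \<Rightarrow> ('r, 'a) rstruct set" where
  "stage a = {A \<in> K. univ A \<subseteq> Y a}"

text \<open>Each \<open>Y b\<close> is compared on its own: a tuple contained in no single earlier
  \<open>Y b\<close> is not known before stage \<open>a\<close>, even if all its entries
  are.\<close>

definition old_below :: "'a \<Rightarrow> ('r, 'a) rstruct \<Rightarrow> ('r, 'a) rstruct \<Rightarrow> bool" where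
  "old_below a C A \<longleftrightarrow>
    (\<forall>b \<in> I. (b, a) \<in> R \<longrightarrow> substructure (restrict_struct A (Y b)) (restrict_struct C (Y b)))"

lemma stage_conds: "a \<in> I \<Longrightarrow> A \<in> stage a \<Longrightarrow> A \<in> conds"
  using covering_systemD(6)[OF system, of a] unfolding stage_def conds_def by blast

lemma restrict_stage: "A \<in> K \<Longrightarrow> restrict_struct A (Y a) \<in> stage a"
  using K_restrict by (auto simp: stage_def)

lemma not_refl_R: "(a, a) \<notin> R"
  using covering_systemD(2)[OF system] by (simp add: wf_irrefl)

text \<open>The traces of \<open>C\<close> on the sets \<open>Z i\<close> agree with each other as
  parts of \<open>C\<close>. A nonempty tuple common to \<open>A\<close> and a trace lies in some
  \<open>Y b\<close> with \<open>b\<close> before \<open>a\<close>, where agreement is assumed;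
  empty tuples are left to \<open>nil_iff\<close>. In the amalgam, the part of \<open>C\<close> in
  an earlier \<open>Y b\<close> is preserved because, being finite, it lies in a single
  \<open>Z i\<close>.\<close>

lemma substructure_union_amalgam:
  assumes a: "a \<in> I" and A: "A \<in> stage a" and C: "C \<in> conds"
    and AC: "\<And>b R' xs. b \<in> I \<Longrightarrow> (b, a) \<in> R \<Longrightarrow> xs \<noteq> [] \<Longrightarrow> set xs \<subseteq> univ A \<inter> univ C \<inter> Y b \<Longrightarrow>
      xs \<in> interp A R' \<longleftrightarrow> xs \<in> interp C R'"
  shows "\<exists>D \<in> conds. substructure A D \<and>
    (\<forall>b \<in> I. (b, a) \<in> R \<longrightarrow> substructure (restrict_struct C (Y b)) D)"
proof -
  have AK: "A \<in> K" and AX: "univ A \<subseteq> X" and CK: "C \<in> K" and CX: "univ C \<subseteq> X"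
    using stage_conds[OF a A] C by (auto simp: conds_def)
  obtain m Z where m: "aleph_le m X"
    and Z: "\<forall>s. finite s \<longrightarrow> s \<noteq> {} \<longrightarrow> ((\<exists>b \<in> I. (b, a) \<in> R \<and> s \<subseteq> Y b) \<longleftrightarrow> (\<exists>i<m. s \<subseteq> Z i))"
    using covering_systemD(9)[OF system a] by blast
  \<comment> \<open>Index \<open>m\<close> carries \<open>A\<close>, so there are
    \<open>m + 1\<close> structures. The amalgamation hypothesis is used with \<open>n = m\<close>;
    for \<open>m = 0\<close> the structure \<open>A\<close> alone will do.\<close>
  define F where "F i = (if i < m then restrict_struct C (Z i) else A)" for i :: nat
  have "\<exists>B \<in> K. \<forall>i < m + 1. substructure (F i) B"
  proof (cases "m \<ge> 1")
    case True
    have FK: "F i \<in> K" for i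
      using K_restrict[OF CK] AK by (simp add: F_def)
    have agree: "agree (F i) (F j)" if "i < j" "j < m + 1" for i j
      unfolding agree_def
    proof (intro allI impI)
      fix S xs assume xs: "set xs \<subseteq> univ (F i)" "set xs \<subseteq> univ (F j)"
      show "xs \<in> interp (F i) S \<longleftrightarrow> xs \<in> interp (F j) S"
      proof (cases "j < m \<or> xs = []")
        case True
        then show ?thesis
        proof
          assume "j < m"
          then show ?thesis using xs \<open>i < j\<close> by (simp add: F_def)
        next
          assume "xs = []"
          then show ?thesis using nil_iff[OF FK FK] by blast
        qed
      next
        case False
        then have "i < m" "\<not> j < m" "xs \<noteq> []" using that by auto
        then have xs': "set xs \<subseteq> univ C" "set xs \<subseteq> Z i" "set xs \<subseteq> univ A"
          using xs by (auto simp: F_def)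
        then obtain b where "b \<in> I" "(b, a) \<in> R" "set xs \<subseteq> Y b"
          using Z[rule_format, of "set xs"] \<open>i < m\<close> \<open>xs \<noteq> []\<close> by auto
        then show ?thesis
          using AC[of b xs S] xs' \<open>i < m\<close> \<open>\<not> j < m\<close> \<open>xs \<noteq> []\<close> by (simp add: F_def)
      qed
    qed
    have "restrict_struct (F i) (univ (F i) \<inter> univ (F j)) = restrict_struct (F j) (univ (F i) \<inter> univ (F j))"
      if "i < j \<and> j < m + 1" for i j
      using that agree by (intro restrict_struct_eqI) blast
    then show ?thesis
      using dap[OF True m] FK unfolding disjoint_amalgamation_def by blast
  next
    case False
    then show ?thesis
      using AK substructure_refl[OF K_struct[OF AK]] by (auto simp: F_def)
  qed
  then obtain B where B: "B \<in> K" "\<And>i. i < m + 1 \<Longrightarrow> substructure (F i) B" by blast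
  \<comment> \<open>The amalgam may have points outside \<open>X\<close>, and conditions must
    not.\<close>
  let ?D = "restrict_struct B X"
  have DK: "?D \<in> K" using B(1) by (rule K_restrict)
  have AB: "substructure A B" using B(2)[of m] by (simp add: F_def)
  have "substructure A ?D"
  proof (rule K_substructureI[OF AK])
    show "univ A \<subseteq> univ ?D" using substructureD(1)[OF AB] AX by simp
    show "xs \<in> interp A S \<longleftrightarrow> xs \<in> interp ?D S" if "set xs \<subseteq> univ A" for S xs
      using substructureD(2)[OF AB that] that AX by auto
  qed
  moreover have "substructure (restrict_struct C (Y b)) ?D" if b: "b \<in> I" "(b, a) \<in> R" for b
  proof (cases "univ C \<inter> Y b = {}")
    \<comment> \<open>The sets \<open>Z i\<close> control nonempty sets only, so an empty trace is
      treated apart; it carries nothing but nullary symbols.\<close>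
    case True
    show ?thesis
    proof (rule K_substructureI[OF K_restrict[OF CK]])
      show "xs \<in> interp (restrict_struct C (Y b)) S \<longleftrightarrow> xs \<in> interp ?D S"
        if "set xs \<subseteq> univ (restrict_struct C (Y b))" for S xs
      proof -
        have "xs = []" using that True by simp
        then show ?thesis using nil_iff[OF K_restrict[OF CK] DK] by blast
      qed
    qed (use True in simp)
  next
    case False
    have "finite (univ C \<inter> Y b)" using K_finite[OF CK] by simp
    then obtain i where i: "i < m" "univ C \<inter> Y b \<subseteq> Z i"
      using Z[rule_format, OF _ False] b by blast
    have CB: "substructure (restrict_struct C (Z i)) B"
      using B(2)[of i] i(1) by (simp add: F_def)
    show ?thesis
    proof (rule K_substructureI[OF K_restrict[OF CK]])
      show "univ (restrict_struct C (Y b)) \<subseteq> univ ?D"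
        using substructureD(1)[OF CB] i(2) CX by auto
      show "xs \<in> interp (restrict_struct C (Y b)) S \<longleftrightarrow> xs \<in> interp ?D S"
        if xs: "set xs \<subseteq> univ (restrict_struct C (Y b))" for S xs
      proof -
        have "set xs \<subseteq> Z i" "set xs \<subseteq> X" "set xs \<subseteq> Y b" using xs i(2) CX by auto
        then show ?thesis
          using substructureD(2)[OF CB, of xs S] xs by auto
      qed
    qed
  qed
  moreover have "?D \<in> conds" using DK by (simp add: conds_def)
  ultimately show ?thesis by blast
qed

lemma substructure_restrict:
  assumes "A \<in> K" "substructure A D" "univ A \<subseteq> S"
  shows "substructure A (restrict_struct D S)"
proof (rule K_substructureI[OF assms(1)])
  show "univ A \<subseteq> univ (restrict_struct D S)"
    using substructureD(1)[OF assms(2)] assms(3) by simp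
  show "xs \<in> interp A R' \<longleftrightarrow> xs \<in> interp (restrict_struct D S) R'" if "set xs \<subseteq> univ A" for xs R'
    using substructureD(2)[OF assms(2) that] that assms(3) by auto
qed

lemma old_below_restrict:
  assumes "C \<in> stage a" "\<forall>b \<in> I. (b, a) \<in> R \<longrightarrow> substructure (restrict_struct C (Y b)) D"
  shows "old_below a (restrict_struct D (Y a)) C"
  unfolding old_below_def
proof (intro ballI impI)
  fix b assume b: "b \<in> I" "(b, a) \<in> R"
  have C: "C \<in> K" "univ C \<subseteq> Y a" using assms(1) by (auto simp: stage_def)
  have "substructure (restrict_struct C (Y b)) (restrict_struct D (Y a))"
    using assms(2) b C(2) by (intro substructure_restrict K_restrict[OF C(1)]) auto
  then show "substructure (restrict_struct C (Y b)) (restrict_struct (restrict_struct D (Y a)) (Y b))"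
    by (rule substructure_restrict[OF K_restrict[OF C(1)]]) simp
qed

text \<open>The projection property is amalgamation over the past, cut down to \<open>Y a\<close>.
  For splitting, a disagreeing pair is placed on new points of \<open>Y a\<close> outside
  \<open>A\<close>. Each of its members amalgamates with \<open>A\<close>, since only the empty
  tuple is common, and no earlier \<open>Y b\<close> sees the difference.\<close>

lemma stage_projection:
  assumes a: "a \<in> I"
  shows "countable_projection (stage a) (\<lambda>B A. substructure A B) (old_below a)"
proof
  show "countable (stage a)"
    unfolding stage_def using covering_systemD(5)[OF system a] by (intro countable_K) auto
  show "substructure A A" if "A \<in> stage a" for A
    using that K_struct substructure_refl unfolding stage_def by blast
  show "substructure C A" if "substructure B A" "substructure C B" for A B C
    using that(2,1) by (rule substructure_trans)
  show "old_below a A C" if "old_below a A B" "old_below a B C" for A B C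
    using that substructure_trans unfolding old_below_def by blast
  show "old_below a A B" if "substructure B A" for A B
    using that substructure_restrict_struct_mono unfolding old_below_def by blast
  show "\<exists>D \<in> stage a. substructure A D \<and> old_below a D C"
    if A: "A \<in> stage a" and C: "C \<in> stage a" and CA: "old_below a C A" for A C
  proof -
    have "\<exists>D \<in> conds. substructure A D \<and>
      (\<forall>b \<in> I. (b, a) \<in> R \<longrightarrow> substructure (restrict_struct C (Y b)) D)"
    proof (rule substructure_union_amalgam[OF a A stage_conds[OF a C]])
      fix b S xs assume b: "b \<in> I" "(b, a) \<in> R" and xs: "set xs \<subseteq> univ A \<inter> univ C \<inter> Y b"
      have "substructure (restrict_struct A (Y b)) (restrict_struct C (Y b))"
        using CA b unfolding old_below_def by blast
      then show "xs \<in> interp A S \<longleftrightarrow> xs \<in> interp C S"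
        using substructureD(2)[of _ _ xs S] xs by fastforce
    qed
    then obtain D where D: "D \<in> conds" "substructure A D"
      "\<forall>b \<in> I. (b, a) \<in> R \<longrightarrow> substructure (restrict_struct C (Y b)) D" by blast
    have "restrict_struct D (Y a) \<in> stage a"
      using D(1) restrict_stage by (simp add: conds_def)
    moreover have "substructure A (restrict_struct D (Y a))"
      using A D(2) by (intro substructure_restrict) (auto simp: stage_def)
    moreover have "old_below a (restrict_struct D (Y a)) C"
      using C D(3) by (rule old_below_restrict)
    ultimately show ?thesis by blast
  qed
  show "\<exists>A0 \<in> stage a. \<exists>A1 \<in> stage a. substructure A A0 \<and> substructure A A1 \<and>
      old_below a A0 A1 \<and> old_below a A1 A0 \<and> \<not> (\<exists>B \<in> stage a. substructure A0 B \<and> substructure A1 B)"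
    if A: "A \<in> stage a" for A
  proof -
    have AK: "A \<in> K" "univ A \<subseteq> Y a" using A by (auto simp: stage_def)
    define N where "N = Y a - (\<Union>b \<in> {b \<in> I. (b, a) \<in> R}. Y b) - univ A"
    have "infinite N"
      unfolding N_def using covering_systemD(7)[OF system a] K_finite[OF AK(1)] by (rule Diff_infinite_finite[rotated])
    then obtain F0 F1 where F: "F0 \<in> K" "F1 \<in> K" "univ F0 = univ F1" "univ F0 \<subseteq> N" "\<not> agree F0 F1"
      using disagreeing_pair by blast
    have ext: "\<exists>B \<in> stage a. univ B = univ A \<union> univ F0 \<and> substructure A B \<and> substructure F B"
      if FK: "F \<in> K" and uF: "univ F = univ F0" for F
    proof -
      have disj: "univ A \<inter> univ F = {}" using uF F(4) by (auto simp: N_def)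
      have AF: "agree A F"
        unfolding agree_def
      proof (intro allI impI)
        fix S xs assume "set xs \<subseteq> univ A" "set xs \<subseteq> univ F"
        then have "xs = []" using disj by (cases xs) auto
        then show "xs \<in> interp A S \<longleftrightarrow> xs \<in> interp F S"
          using nil_iff[OF AK(1) FK] by simp
      qed
      obtain B where "B \<in> K" "univ B = univ A \<union> univ F" "substructure A B" "substructure F B"
        using disjoint_amalgam[OF AK(1) FK AF] by blast
      then show ?thesis
        using uF F(4) AK(2) by (intro bexI[of _ B]) (auto simp: stage_def N_def)
    qed
    obtain B0 where B0: "B0 \<in> stage a" "univ B0 = univ A \<union> univ F0" "substructure A B0" "substructure F0 B0"
      using ext[OF F(1)] by blast
    obtain B1 where B1: "B1 \<in> stage a" "univ B1 = univ A \<union> univ F0" "substructure A B1" "substructure F1 B1"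
      using ext[OF F(2) F(3)[symmetric]] by blast
    have old: "old_below a B C"
      if B: "B \<in> stage a" "univ B = univ A \<union> univ F0" "substructure A B"
        and C: "C \<in> stage a" "univ C = univ A \<union> univ F0" "substructure A C" for B C
      unfolding old_below_def
    proof (intro ballI impI)
      fix b assume b: "b \<in> I" "(b, a) \<in> R"
      have CK: "C \<in> K" using C(1) by (simp add: stage_def)
      have "univ F0 \<inter> Y b = {}" using F(4) b unfolding N_def by blast
      then have Yb: "(univ A \<union> univ F0) \<inter> Y b \<subseteq> univ A" by blast
      show "substructure (restrict_struct C (Y b)) (restrict_struct B (Y b))"
      proof (rule K_substructureI[OF K_restrict[OF CK]])
        show "univ (restrict_struct C (Y b)) \<subseteq> univ (restrict_struct B (Y b))"
          by (simp add: B(2) C(2))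
        fix S xs assume "set xs \<subseteq> univ (restrict_struct C (Y b))"
        then have "set xs \<subseteq> univ A" using Yb by (auto simp: C(2))
        then show "xs \<in> interp (restrict_struct C (Y b)) S \<longleftrightarrow> xs \<in> interp (restrict_struct B (Y b)) S"
          using substructureD(2)[OF B(3), of xs S] substructureD(2)[OF C(3), of xs S] by simp
      qed
    qed
    have "\<not> (\<exists>B \<in> stage a. substructure B0 B \<and> substructure B1 B)"
      using F(5) substructure_agree substructure_trans[OF B0(4)] substructure_trans[OF B1(4)] by blast
    then show ?thesis
      using B0(1,3) B1(1,3) old[OF B0(1-3) B1(1-3)] old[OF B1(1-3) B0(1-3)]
      by (intro bexI[of _ B0] bexI[of _ B1] conjI)
  qed
qed

end

locale covered_class_bits = covered_class ar K X I R Y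
  for ar :: "'r::finite \<Rightarrow> nat" and K :: "('r, 'a) rstruct set"
    and X I :: "'a set" and R :: "'a rel" and Y :: "'a \<Rightarrow> 'a set" +
  fixes U :: "'a \<Rightarrow> nat \<Rightarrow> bool \<Rightarrow> ('r, 'a) rstruct set"
  assumes U_down: "a \<in> I \<Longrightarrow> A \<in> stage a \<Longrightarrow> substructure B A \<Longrightarrow> B \<in> U a k v \<Longrightarrow> A \<in> U a k v"
    and U_disjoint: "a \<in> I \<Longrightarrow> U a k True \<inter> U a k False = {}"
    and U_independent: "a \<in> I \<Longrightarrow> C \<in> stage a \<Longrightarrow>
      \<exists>A \<in> stage a. old_below a A C \<and> (\<forall>k<length \<sigma>. A \<in> U a k (\<sigma> ! k))"
    and U_dense: "a \<in> I \<Longrightarrow> A \<in> stage a \<Longrightarrow>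
      \<exists>A' \<in> stage a. substructure A A' \<and> (\<exists>\<sigma>. \<forall>C \<in> stage a. old_below a C A' \<longrightarrow>
        (\<forall>k<length \<sigma>. C \<in> U a k (\<sigma> ! k)) \<longrightarrow> (\<exists>D \<in> stage a. substructure C D \<and> substructure A D))"
begin

section \<open>Independence and density of the bits of all stages\<close>

definition reads :: "('r, 'a) rstruct \<Rightarrow> 'a \<Rightarrow> bool list \<Rightarrow> bool" where
  "reads C a \<sigma> \<longleftrightarrow> (\<forall>k<length \<sigma>. restrict_struct C (Y a) \<in> U a k (\<sigma> ! k))"

lemma reads_mono:
  assumes "a \<in> I" "D \<in> K" "substructure (restrict_struct C (Y a)) D" "reads C a \<sigma>"
  shows "reads D a \<sigma>"
proof -
  have "substructure (restrict_struct C (Y a)) (restrict_struct D (Y a))"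
    using substructure_restrict_struct_mono[OF assms(3), of "Y a"] by (simp add: restrict_struct_def inf_assoc)
  then show ?thesis
    using assms(4) U_down[OF assms(1) restrict_stage[OF assms(2)]] unfolding reads_def by blast
qed

text \<open>Induction on the number of stages, the last stage \<open>a\<close> being removed. A
  condition realising the other patterns is preserved on the earlier \<open>Y b\<close>, which is
  all that those patterns look at, and independence at stage \<open>a\<close> over this past
  supplies the pattern for \<open>a\<close>.\<close>

lemma reads_independent:
  assumes "finite F" "F \<subseteq> I"
  shows "\<exists>C \<in> conds. \<forall>a \<in> F. reads C a (\<sigma> a)"
  using assms
proof (induction "card F" arbitrary: F)
  case 0
  obtain A where "A \<in> K" using nontrivial unfolding nontrivial_class_def by blast
  then have "restrict_struct A {} \<in> conds" using K_restrict by (simp add: conds_def)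
  then show ?case using 0 by auto
next
  case (Suc n)
  then have "F \<noteq> {}" by auto
  obtain a where a: "a \<in> F" "\<And>b. (a, b) \<in> R \<Longrightarrow> b \<notin> F"
    using finite_max_wf[OF covering_systemD(2)[OF system] Suc.prems(1) \<open>F \<noteq> {}\<close>] by blast
  have aI: "a \<in> I" using a(1) Suc.prems(2) by blast
  have below: "(b, a) \<in> R" if "b \<in> F - {a}" for b
    using a(2)[of b] that aI Suc.prems(2) covering_systemD(4)[OF system] unfolding total_on_def by blast
  have "n = card (F - {a})" using Suc.hyps(2) a(1) Suc.prems(1) by simp
  then obtain C where C: "C \<in> conds" "\<forall>b \<in> F - {a}. reads C b (\<sigma> b)"
    using Suc.hyps(1)[of "F - {a}"] Suc.prems by blast
  have CK: "C \<in> K" using C(1) by (simp add: conds_def)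
  let ?C = "restrict_struct C (Y a)"
  obtain A where A: "A \<in> stage a" "old_below a A ?C" "\<forall>k<length (\<sigma> a). A \<in> U a k (\<sigma> a ! k)"
    using U_independent[OF aI restrict_stage[OF CK]] by blast
  have AK: "A \<in> K" "univ A \<subseteq> Y a" using A(1) by (auto simp: stage_def)
  have "\<exists>D \<in> conds. substructure A D \<and>
      (\<forall>b \<in> I. (b, a) \<in> R \<longrightarrow> substructure (restrict_struct C (Y b)) D)"
  proof (rule substructure_union_amalgam[OF aI A(1) C(1)])
    fix b S xs assume b: "b \<in> I" "(b, a) \<in> R" and xs: "set xs \<subseteq> univ A \<inter> univ C \<inter> Y b"
    have "substructure (restrict_struct ?C (Y b)) (restrict_struct A (Y b))"
      using A(2) b unfolding old_below_def by blast
    moreover have "set xs \<subseteq> Y a" "set xs \<subseteq> Y b" "set xs \<subseteq> univ C" using xs AK(2) by auto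
    ultimately show "xs \<in> interp A S \<longleftrightarrow> xs \<in> interp C S"
      using substructureD(2)[of "restrict_struct ?C (Y b)" "restrict_struct A (Y b)" xs S] by simp
  qed
  then obtain D where D: "D \<in> conds" "substructure A D"
    "\<forall>b \<in> I. (b, a) \<in> R \<longrightarrow> substructure (restrict_struct C (Y b)) D" by blast
  have DK: "D \<in> K" using D(1) by (simp add: conds_def)
  have "reads D b (\<sigma> b)" if "b \<in> F" for b
  proof (cases "b = a")
    case True
    have "substructure A (restrict_struct D (Y a))"
      using AK D(2) by (intro substructure_restrict) auto
    then show ?thesis
      using True A(3) U_down[OF aI restrict_stage[OF DK]] unfolding reads_def by blast
  next
    case False
    then have b: "b \<in> F - {a}" using that by simp
    then show ?thesis
      using reads_mono[OF _ DK] D(3) below[OF b] C(2) Suc.prems(2) that by blast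
  qed
  then show ?case using D(1) by blast
qed

text \<open>The claim covers all stages up to \<open>a\<close>, since the induction needs control
  over the past. The density property at stage \<open>a\<close> requires a past below that of an
  extension \<open>A'\<close> of the trace of \<open>D\<close>, which may say more than
  \<open>D\<close>. Hence \<open>D\<close> is replaced by a condition \<open>D'\<close> that
  contains \<open>A'\<close> and the earlier traces of \<open>D\<close>, and the induction
  hypothesis is applied to \<open>D'\<close>.\<close>

lemma reads_dense:
  assumes "a \<in> I" "D \<in> conds"
  shows "\<exists>F \<sigma>. finite F \<and> F \<subseteq> {b \<in> I. b = a \<or> (b, a) \<in> R} \<and>
    (\<forall>C \<in> conds. (\<forall>b \<in> F. reads C b (\<sigma> b)) \<longrightarrow>
      (\<forall>b \<in> I. b = a \<or> (b, a) \<in> R \<longrightarrow> agree C (restrict_struct D (Y b))))"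
  using covering_systemD(2)[OF system] assms
proof (induction a arbitrary: D rule: wf_induct_rule)
  case (less a)
  have aI: "a \<in> I" by fact
  have DK: "D \<in> K" using less.prems by (simp add: conds_def)
  let ?A = "restrict_struct D (Y a)"
  obtain A' \<tau> where A': "A' \<in> stage a" "substructure ?A A'"
    and \<tau>: "\<And>C. C \<in> stage a \<Longrightarrow> old_below a C A' \<Longrightarrow> \<forall>k<length \<tau>. C \<in> U a k (\<tau> ! k) \<Longrightarrow>
      \<exists>E \<in> stage a. substructure C E \<and> substructure ?A E"
    using U_dense[OF aI restrict_stage[OF DK]] by blast
  have A'K: "A' \<in> K" "univ A' \<subseteq> Y a" using A'(1) by (auto simp: stage_def)
  have "\<exists>D' \<in> conds. substructure A' D' \<and>
      (\<forall>b \<in> I. (b, a) \<in> R \<longrightarrow> substructure (restrict_struct D (Y b)) D')"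
  proof (rule substructure_union_amalgam[OF aI A'(1) less.prems(2)])
    fix b S xs assume "set xs \<subseteq> univ A' \<inter> univ D \<inter> Y b"
    then have "set xs \<subseteq> Y a" "set xs \<subseteq> univ D" using A'K(2) by auto
    then show "xs \<in> interp A' S \<longleftrightarrow> xs \<in> interp D S"
      using substructureD(2)[OF A'(2), of xs S] by simp
  qed
  then obtain D' where D': "D' \<in> conds" "substructure A' D'"
    "\<And>b. b \<in> I \<Longrightarrow> (b, a) \<in> R \<Longrightarrow> substructure (restrict_struct D (Y b)) D'" by blast
  have D'K: "D' \<in> K" using D'(1) by (simp add: conds_def)
  let ?L = "{b \<in> I. (b, a) \<in> R}"
  have "\<exists>F \<sigma>. finite F \<and> F \<subseteq> ?L \<and>
    (\<forall>C \<in> conds. (\<forall>b \<in> F. reads C b (\<sigma> b)) \<longrightarrow> (\<forall>b \<in> ?L. agree C (restrict_struct D' (Y b))))"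
  proof (cases "?L = {}")
    case True
    show ?thesis by (rule exI[of _ "{}"]) (simp add: True)
  next
    case False
    \<comment> \<open>Only finitely many traces \<open>univ D' \<inter> Y b\<close> occur, so one application of the induction
      hypothesis, at the largest of finitely many representatives, suffices.\<close>
    let ?t = "\<lambda>b. univ D' \<inter> Y b"
    have fin: "finite (?t ` ?L)"
      by (rule finite_subset[of _ "Pow (univ D')"]) (use K_finite[OF D'K] in auto)
    then obtain B where B: "B \<subseteq> ?L" "finite B" "?t ` ?L = ?t ` B"
      using finite_subset_image[OF fin subset_refl] by (elim exE conjE)
    then have "B \<noteq> {}" using False by auto
    then obtain c where c: "c \<in> B" "\<And>b. (c, b) \<in> R \<Longrightarrow> b \<notin> B"
      using finite_max_wf[OF covering_systemD(2)[OF system] B(2)] by blast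
    have cL: "c \<in> I" "(c, a) \<in> R" using c(1) B(1) by auto
    obtain F \<sigma> where F: "finite F" "F \<subseteq> {b \<in> I. b = c \<or> (b, c) \<in> R}"
      and *: "\<forall>C \<in> conds. (\<forall>b \<in> F. reads C b (\<sigma> b)) \<longrightarrow>
        (\<forall>b \<in> I. b = c \<or> (b, c) \<in> R \<longrightarrow> agree C (restrict_struct D' (Y b)))"
      using less.IH[OF cL(2) cL(1) D'(1)] by (elim exE conjE)
    have "F \<subseteq> ?L"
      using F(2) cL transD[OF covering_systemD(3)[OF system]] by blast
    moreover have "agree C (restrict_struct D' (Y b))"
      if C: "C \<in> conds" "\<forall>b \<in> F. reads C b (\<sigma> b)" and b: "b \<in> ?L" for C b
    proof -
      have "?t b \<in> ?t ` B" using b B(3) by blast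
      then obtain b' where b': "b' \<in> B" "?t b = ?t b'" by blast
      have "b' \<in> I" "b' = c \<or> (b', c) \<in> R"
        using b'(1) c B(1) cL(1) covering_systemD(4)[OF system] unfolding total_on_def by blast+
      then have ag: "agree C (restrict_struct D' (Y b'))"
        using * C by blast
      show ?thesis
        unfolding agree_def
      proof (intro allI impI)
        fix S xs assume xs: "set xs \<subseteq> univ C" "set xs \<subseteq> univ (restrict_struct D' (Y b))"
        then have xs': "set xs \<subseteq> univ (restrict_struct D' (Y b'))" using b'(2) by simp
        then show "xs \<in> interp C S \<longleftrightarrow> xs \<in> interp (restrict_struct D' (Y b)) S"
          using agreeD[OF ag xs(1) xs', of S] xs(2) by simp
      qed
    qed
    ultimately show ?thesis using F(1) by (intro exI[of _ F] exI[of _ \<sigma>]) blast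
  qed
  then obtain F \<sigma> where F: "finite F" "F \<subseteq> ?L"
    and old': "\<forall>C \<in> conds. (\<forall>b \<in> F. reads C b (\<sigma> b)) \<longrightarrow>
      (\<forall>b \<in> ?L. agree C (restrict_struct D' (Y b)))"
    by (elim exE conjE)
  have old: "agree C (restrict_struct D' (Y b))"
    if "C \<in> conds" "\<forall>b \<in> F. reads C b (\<sigma> b)" "b \<in> I" "(b, a) \<in> R" for C b
    using old' that by blast
  have aF: "a \<notin> F" using F(2) not_refl_R by blast
  have "agree C (restrict_struct D (Y b))"
    if C: "C \<in> conds" and reads: "\<forall>b \<in> insert a F. reads C b ((\<sigma>(a := \<tau>)) b)"
      and b: "b \<in> I" "b = a \<or> (b, a) \<in> R" for C b
  proof -
    have CK: "C \<in> K" using C by (simp add: conds_def)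
    have ra: "reads C a \<tau>"
      using reads by simp
    have rF: "\<forall>b \<in> F. reads C b (\<sigma> b)"
    proof
      fix b assume "b \<in> F"
      then show "reads C b (\<sigma> b)" using bspec[OF reads, of b] aF by (cases "b = a") auto
    qed
    show ?thesis
    proof (cases "b = a")
      case False
      then have b': "(b, a) \<in> R" using b(2) by simp
      show ?thesis
        unfolding agree_def
      proof (intro allI impI)
        fix S xs assume xs: "set xs \<subseteq> univ C" "set xs \<subseteq> univ (restrict_struct D (Y b))"
        then have xs': "set xs \<subseteq> univ (restrict_struct D' (Y b))"
          using substructureD(1)[OF D'(3)[OF b(1) b']] by auto
        then show "xs \<in> interp C S \<longleftrightarrow> xs \<in> interp (restrict_struct D (Y b)) S"
          using agreeD[OF old[OF C rF b(1) b'] xs(1) xs', of S] substructureD(2)[OF D'(3)[OF b(1) b'] xs(2), of S]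
          by auto
      qed
    next
      case True
      let ?C = "restrict_struct C (Y a)"
      \<comment> \<open>\<open>C\<close> agrees with the past of \<open>A'\<close> but need not
        contain it. Adding that past gives \<open>E\<close>, to which the choice of
        \<open>\<tau>\<close> applies; a common extension of \<open>?E\<close> and \<open>?A\<close>
        then makes \<open>C\<close> agree with \<open>D\<close> on \<open>Y a\<close>.\<close>
      have "\<exists>E \<in> conds. substructure ?C E \<and>
          (\<forall>b \<in> I. (b, a) \<in> R \<longrightarrow> substructure (restrict_struct A' (Y b)) E)"
      proof (rule substructure_union_amalgam[OF aI restrict_stage[OF CK] stage_conds[OF aI A'(1)]])
        fix b S xs assume b: "b \<in> I" "(b, a) \<in> R" and xs: "set xs \<subseteq> univ ?C \<inter> univ A' \<inter> Y b"
        then have xs': "set xs \<subseteq> univ C" "set xs \<subseteq> univ A'" "set xs \<subseteq> Y a" "set xs \<subseteq> Y b" by auto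
        then have "set xs \<subseteq> univ (restrict_struct D' (Y b))"
          using substructureD(1)[OF D'(2)] by auto
        then show "xs \<in> interp ?C S \<longleftrightarrow> xs \<in> interp A' S"
          using agreeD[OF old[OF C rF b] xs'(1), of S] substructureD(2)[OF D'(2) xs'(2), of S] xs' by simp
      qed
      then obtain E where E: "E \<in> conds" "substructure ?C E"
        "\<forall>b \<in> I. (b, a) \<in> R \<longrightarrow> substructure (restrict_struct A' (Y b)) E" by blast
      let ?E = "restrict_struct E (Y a)"
      have Es: "?E \<in> stage a" using E(1) by (intro restrict_stage) (simp add: conds_def)
      have CE: "substructure ?C ?E"
        using E(2) K_restrict[OF CK] by (intro substructure_restrict) auto
      have "\<forall>k<length \<tau>. ?E \<in> U a k (\<tau> ! k)"
        using ra U_down[OF aI Es CE] unfolding reads_def by blast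
      then obtain G where G: "substructure ?E G" "substructure ?A G"
        using \<tau>[OF Es old_below_restrict[OF A'(1) E(3)]] by blast
      have "agree ?C ?A"
        using substructure_agree[OF substructure_trans[OF CE G(1)] G(2)] .
      then show ?thesis
        using True unfolding agree_def by auto
    qed
  qed
  then show ?case
    using F aI by (intro exI[of _ "insert a F"] exI[of _ "\<sigma>(a := \<tau>)"]) auto
qed

lemma forcing_equivalent_struct_forcing:
  assumes "infinite X"
  shows "forcing_equivalent (struct_forcing X K) (cohen_forcing X)"
proof -
  obtain f where f: "bij_betw f X (I \<times> (UNIV :: nat set))"
    using covering_system_bij[OF assms system] by blast
  have Fld: "Field (struct_forcing X K) = conds"
    using Field_struct_forcing[OF fraisse] by (simp add: conds_def)
  have sf: "(D, C) \<in> struct_forcing X K \<longleftrightarrow> D \<in> conds \<and> C \<in> conds \<and> substructure C D" for C D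
    unfolding struct_forcing_def conds_def by (simp add: conj_ac)
  \<comment> \<open>Coordinate \<open>x\<close> with \<open>f x = (a, k)\<close> is the
    \<open>k\<close>-th bit of stage \<open>a\<close>, evaluated on the trace in
    \<open>Y a\<close>.\<close>
  define V where "V x v = {C \<in> conds. restrict_struct C (Y (fst (f x))) \<in> U (fst (f x)) (snd (f x)) v}" for x v
  have fI: "fst (f x) \<in> I" if "x \<in> X" for x
    using bij_betw_apply[OF f that] by (simp add: mem_Times_iff)
  have cell: "cell (struct_forcing X K) V p = {C \<in> conds. \<forall>x v. p x = Some v \<longrightarrow> C \<in> V x v}" for p
    by (simp add: cell_def Fld)
  show ?thesis
  proof (rule forcing_equivalent_cohenI[of "struct_forcing X K" X V])
    show "Partial_order (struct_forcing X K)"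
      using fraisse by (rule Partial_order_struct_forcing)
    show "D \<in> V x v" if x: "x \<in> X" and C: "C \<in> V x v" and DC: "(D, C) \<in> struct_forcing X K" for x v C D
    proof -
      have "D \<in> conds" "D \<in> K" "substructure C D" using DC by (auto simp: sf conds_def)
      then show ?thesis
        using C U_down[OF fI[OF x] restrict_stage substructure_restrict_struct_mono]
        unfolding V_def by blast
    qed
    show "V x True \<inter> V x False = {}" if "x \<in> X" for x
      using U_disjoint[OF fI[OF that]] unfolding V_def by blast
    show "cell (struct_forcing X K) V p \<noteq> {}" if p: "finite (dom p)" "dom p \<subseteq> X" for p
    proof -
      define g where "g = inv_into X f"
      have gf: "g (f x) = x" if "x \<in> X" for x
        using f that unfolding g_def bij_betw_def by simp
      have "finite ((snd \<circ> f) ` dom p)" using p(1) by simp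
      then obtain n where n: "\<And>x. x \<in> dom p \<Longrightarrow> snd (f x) < n"
        unfolding finite_nat_set_iff_bounded by auto
      \<comment> \<open>A pattern is an initial segment of the bits of its stage, so bits on which
        \<open>p\<close> is silent are filled with \<open>False\<close>.\<close>
      define \<sigma> where "\<sigma> a = map (\<lambda>k. p (g (a, k)) = Some True) [0..<n]" for a
      have "finite ((fst \<circ> f) ` dom p)" and "(fst \<circ> f) ` dom p \<subseteq> I"
        using p fI by auto
      then obtain C where C: "C \<in> conds" "\<forall>a \<in> (fst \<circ> f) ` dom p. reads C a (\<sigma> a)"
        using reads_independent[of "(fst \<circ> f) ` dom p" \<sigma>] by blast
      have "C \<in> V x v" if "p x = Some v" for x v
      proof -
        have x: "x \<in> dom p" "x \<in> X" using that p(2) by auto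
        have "reads C (fst (f x)) (\<sigma> (fst (f x)))" using C(2) x(1) by simp
        moreover have "snd (f x) < length (\<sigma> (fst (f x)))" using n[OF x(1)] by (simp add: \<sigma>_def)
        moreover have "\<sigma> (fst (f x)) ! snd (f x) = v"
          using n[OF x(1)] gf[OF x(2)] that by (simp add: \<sigma>_def)
        ultimately show ?thesis using C(1) unfolding reads_def V_def by blast
      qed
      then show ?thesis using C(1) cell by blast
    qed
    show "\<exists>p. finite (dom p) \<and> dom p \<subseteq> X \<and> (\<forall>D \<in> cell (struct_forcing X K) V p.
        \<exists>E. (E, C) \<in> struct_forcing X K \<and> (E, D) \<in> struct_forcing X K)"
      if "C \<in> Field (struct_forcing X K)" for C
    proof -
      have C: "C \<in> conds" using that Fld by simp
      then have CK: "C \<in> K" "univ C \<subseteq> X" by (auto simp: conds_def)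
      \<comment> \<open>With \<open>univ C\<close> inside one \<open>Y a\<close>, agreement with the
        trace on \<open>Y a\<close> is agreement with \<open>C\<close>, and two agreeing conditions
        have a common extension by strong amalgamation.\<close>
      obtain a where a: "a \<in> I" "univ C \<subseteq> Y a"
        using covering_systemD(8)[OF system K_finite[OF CK(1)] CK(2)] by blast
      obtain F \<sigma> where F: "finite F" "F \<subseteq> I"
        and dense: "\<forall>D \<in> conds. (\<forall>b \<in> F. reads D b (\<sigma> b)) \<longrightarrow> agree D (restrict_struct C (Y a))"
      proof -
        obtain F \<sigma> where F: "finite F" "F \<subseteq> {b \<in> I. b = a \<or> (b, a) \<in> R}"
          and "\<forall>D \<in> conds. (\<forall>b \<in> F. reads D b (\<sigma> b)) \<longrightarrow>
            (\<forall>b \<in> I. b = a \<or> (b, a) \<in> R \<longrightarrow> agree D (restrict_struct C (Y b)))"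
          using reads_dense[OF a(1) C] by (elim exE conjE)
        then have "\<forall>D \<in> conds. (\<forall>b \<in> F. reads D b (\<sigma> b)) \<longrightarrow> agree D (restrict_struct C (Y a))"
          using a(1) by blast
        then show ?thesis using F that[of F \<sigma>] by blast
      qed
      \<comment> \<open>Finitely many coordinates, enough to prescribe every pattern
        \<open>\<sigma> b\<close> in full.\<close>
      define T where "T = (SIGMA b : F. {..<length (\<sigma> b)})"
      define p where "p x = (if x \<in> X \<and> f x \<in> T then Some (\<sigma> (fst (f x)) ! snd (f x)) else None)" for x
      have "finite T" using F(1) by (simp add: T_def)
      have domp: "dom p = {x \<in> X. f x \<in> T}" by (auto simp: p_def split: if_splits)
      have "finite (dom p)"
      proof (rule finite_imageD)
        show "finite (f ` dom p)" using \<open>finite T\<close> by (rule finite_subset[rotated]) (auto simp: domp)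
        show "inj_on f (dom p)" using f unfolding domp bij_betw_def by (auto intro: inj_on_subset)
      qed
      moreover have "\<exists>E. (E, C) \<in> struct_forcing X K \<and> (E, D) \<in> struct_forcing X K"
        if D: "D \<in> cell (struct_forcing X K) V p" for D
      proof -
        have Dc: "D \<in> conds" and DV: "\<And>x v. p x = Some v \<Longrightarrow> D \<in> V x v" using D cell by auto
        then have DK: "D \<in> K" "univ D \<subseteq> X" by (auto simp: conds_def)
        have "reads D b (\<sigma> b)" if b: "b \<in> F" for b
          unfolding reads_def
        proof (intro allI impI)
          fix k assume k: "k < length (\<sigma> b)"
          have "(b, k) \<in> f ` X" using f b F(2) by (auto simp: bij_betw_def)
          then obtain x where x: "x \<in> X" "f x = (b, k)" by auto
          then have "p x = Some (\<sigma> b ! k)" using b k by (simp add: p_def T_def)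
          from DV[OF this] show "restrict_struct D (Y b) \<in> U b k (\<sigma> b ! k)"
            using x(2) by (simp add: V_def)
        qed
        then have "agree D (restrict_struct C (Y a))" using dense Dc by blast
        then have "agree D C" using a(2) unfolding agree_def by auto
        then obtain E where "E \<in> K" "univ E = univ D \<union> univ C" "substructure D E" "substructure C E"
          using disjoint_amalgam[OF DK(1) CK(1)] by blast
        then have "E \<in> conds" "(E, C) \<in> struct_forcing X K" "(E, D) \<in> struct_forcing X K"
          using CK DK C Dc by (auto simp: sf conds_def)
        then show ?thesis by blast
      qed
      moreover have "dom p \<subseteq> X" by (auto simp: domp)
      ultimately show ?thesis by blast
    qed
  qed
qed

end

theorem theorem1p2:
  fixes ar :: "'r::finite \<Rightarrow> nat"
    and K :: "('r, 'a) rstruct set"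
    and X :: "'a set"
  assumes "strong_fraisse_class ar K"
    and "nontrivial_class K"
    and "countably_many_iso_types K"
    and "infinite X"
    and "\<And>n. n \<ge> 1 \<Longrightarrow> aleph_le n X \<Longrightarrow> disjoint_amalgamation (n + 1) K"
  shows "forcing_equivalent (struct_forcing X K) (cohen_forcing X)"
proof -
  obtain I R Y where system: "covering_system X I R Y"
    using covering_system_exists[OF assms(4)] by blast
  interpret covered_class ar K X I R Y
  proof unfold_locales
    show "strong_fraisse_class ar K" "nontrivial_class K" "covering_system X I R Y"
      by (fact assms(1) assms(2) system)+
    show "disjoint_amalgamation (n + 1) K" if "n \<ge> 1" "aleph_le n X" for n
      using that by (rule assms(5))
  qed
  let ?bits = "\<lambda>a U. (\<forall>k v A B. A \<in> stage a \<longrightarrow> substructure B A \<longrightarrow> B \<in> U k v \<longrightarrow> A \<in> U k v) \<and>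
    (\<forall>k. U k True \<inter> U k False = {}) \<and>
    (\<forall>C \<in> stage a. \<forall>\<sigma>. \<exists>A \<in> stage a. old_below a A C \<and> (\<forall>k<length \<sigma>. A \<in> U k (\<sigma> ! k))) \<and>
    (\<forall>A \<in> stage a. \<exists>A' \<in> stage a. substructure A A' \<and> (\<exists>\<sigma>. \<forall>C \<in> stage a. old_below a C A' \<longrightarrow>
      (\<forall>k<length \<sigma>. C \<in> U k (\<sigma> ! k)) \<longrightarrow> (\<exists>D \<in> stage a. substructure C D \<and> substructure A D)))"
  \<comment> \<open>Bits exist at each stage separately and are chosen for all stages at once;
    afterwards only the listed properties are used.\<close>
  have "\<forall>a \<in> I. \<exists>U :: nat \<Rightarrow> bool \<Rightarrow> ('r, 'a) rstruct set. ?bits a U"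
    by (intro ballI countable_projection.independent_bits[OF stage_projection])
  then obtain U :: "'a \<Rightarrow> nat \<Rightarrow> bool \<Rightarrow> ('r, 'a) rstruct set" where U: "\<forall>a \<in> I. ?bits a (U a)"
    by (rule bchoice[THEN exE])
  interpret covered_class_bits ar K X I R Y U
  proof unfold_locales
    fix a assume a: "a \<in> I"
    note Ua = bspec[OF U a]
    show "A \<in> stage a \<Longrightarrow> substructure B A \<Longrightarrow> B \<in> U a k v \<Longrightarrow> A \<in> U a k v" for A B k v
      using Ua by blast
    show "U a k True \<inter> U a k False = {}" for k
      using Ua by blast
    show "C \<in> stage a \<Longrightarrow> \<exists>A \<in> stage a. old_below a A C \<and> (\<forall>k<length \<sigma>. A \<in> U a k (\<sigma> ! k))" for C \<sigma>
      using Ua by blast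
    show "A \<in> stage a \<Longrightarrow> \<exists>A' \<in> stage a. substructure A A' \<and> (\<exists>\<sigma>. \<forall>C \<in> stage a. old_below a C A' \<longrightarrow>
        (\<forall>k<length \<sigma>. C \<in> U a k (\<sigma> ! k)) \<longrightarrow> (\<exists>D \<in> stage a. substructure C D \<and> substructure A D))" for A
      using Ua by blast
  qed
  show ?thesis
    using assms(4) by (rule forcing_equivalent_struct_forcing)
qed

end
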